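(* Let $n,m,p\ge 1$ be integers with $\tau(p)>m$. Fix a linear map $\mathcal A:\mathbb S^n\to\mathbb R^m$, a vector $b\in\mathbb R^m$ and constants $R_Y,R_\lambda\in\mathbb R_+$. Let $\boldsymbol\varepsilon=(\varepsilon_0,\varepsilon_1,\varepsilon_2)\in\mathbb R_+^3$ and $\gamma>0$. Let $\bar C\in\mathbb S^n$, $\sigma>0$, and let $C$ be uniformly distributed on the Frobenius ball in $\mathbb S^n$ of radius $\sigma$ centered at $\bar C$. Set $\delta:=\varepsilon_1\|\mathcal A\|/\gamma$ and $\kappa:=R_\lambda\|\mathcal A\|$. If $\delta<\dfrac{\sigma}{4n^3}$, then $$\Pr[\,C\in\mathscr C_{\boldsymbol\varepsilon,\gamma}\,]\;\le\;4e\,\delta^{\tau(p)-m}\,(3\kappa)^m\,\Big(\frac{4n^3}{\sigma}\Big)^{\tau(p)},$$ where $\mathscr C_{\boldsymbol\varepsilon,\gamma}\subset\mathbb S^n$ is the set of cost matrices for which there exists a spurious $(\boldsymbol\varepsilon,\gamma)$-AFAC pair.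
   Context: $\mathbb S^n$ is the space of real symmetric $n\times n$ matrices, $A\bullet B=\operatorname{tr}(A^TB)$, all matrix norms are Frobenius norms, $\mathbb R_+=[0,\infty)$, and $\tau(k)=\binom{k+1}{2}$. The linear map is $\mathcal A(X)=(A_1\bullet X,\dots,A_m\bullet X)$ with $A_i\in\mathbb S^n$ (the same formula is used for nonsymmetric $X\in\mathbb R^{n\times n}$), $\|\mathcal A\|$ is its operator norm, and $\mathcal A^*(\lambda)=\sum_i\lambda_iA_i$. For $C\in\mathbb S^n$ and $\lambda\in\mathbb R^m$ the slack matrix is $S(\lambda)=C-\mathcal A^*(\lambda)$. The semidefinite program is (SDP): $\min_{X\in\mathbb S^n} C\bullet X$ s.t. $\mathcal A(X)=b$, $X\succeq0$; the Burer-Monteiro problem is (BM): $\min_{Y\in\mathbb R^{n\times p}} C\bullet YY^T$ s.t. $\mathcal A(YY^T)=b$. Approximate optimality: a pair $(X,\lambda)$ is $(\varepsilon_0,\varepsilon_1,\varepsilon_2)$-approximately optimal for (SDP) if $\|\mathcal A(X)-b\|\le\varepsilon_0$, $\|S(\lambda)X\|\le\varepsilon_1$, $X\succeq0$, $S(\lambda)\succeq-\varepsilon_2 I_n$. AFAC: a pair $(Y,\lambda)\in\mathbb R^{n\times p}\times\mathbb R^m$ is $(\boldsymbol\varepsilon,\gamma)$-AFAC (approximately feasible approximately 2-critical) for (BM) if $\|\mathcal A(YY^T)-b\|\le\varepsilon_0$, $\|S(\lambda)Y\|\le\varepsilon_1$, and $S(\lambda)\bullet UU^T\ge-\varepsilon_2$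 for all $U\in\mathbb R^{n\times p}$ with $\|U\|=1$ and $\|\mathcal A(UY^T)\|\le\gamma$. Spurious: $(Y,\lambda)$ is a spurious $(\boldsymbol\varepsilon,\gamma)$-AFAC pair if it is $(\boldsymbol\varepsilon,\gamma)$-AFAC for (BM), $(YY^T,\lambda)$ is not $(\varepsilon_0,R_Y\varepsilon_1,\varepsilon_2)$-approximately optimal for (SDP), and $\|Y\|\le R_Y$, $\|\lambda\|\le R_\lambda$. The set $\mathscr C_{\boldsymbol\varepsilon,\gamma}$ is defined with $\mathcal A,b,p,R_Y,R_\lambda$ fixed and $C$ varying.
   Formalization: The additional hypothesis δ ≤ κ (that is, ε₁ ≤ γR_λ or ‖𝒜‖ = 0) is assumed; without it the bound fails, for example when R_λ = 0 and ε₁ > 0, where the right-hand side is 0 but the probability can be positive. *)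

theory Defs
  imports "HOL-Probability.Probability"
begin

text \<open>
  An \<open>n \<times> p\<close> matrix is of type \<^typ>\<open>real^'p^'n\<close>.  The library's \<^const>\<open>inner\<close> and \<^const>\<open>norm\<close>
  on this type are the Frobenius inner product and the Frobenius norm:
\<close>

lemma inner_matrix_eq_trace:
  fixes A B :: "real^'p^'n"
  shows "A \<bullet> B = trace (transpose A ** B)"
proof -
  have "A \<bullet> B = (\<Sum>i\<in>UNIV. \<Sum>j\<in>UNIV. A $ i $ j * B $ i $ j)"
    by (simp add: inner_vec_def)
  also have "\<dots> = (\<Sum>j\<in>UNIV. \<Sum>i\<in>UNIV. A $ i $ j * B $ i $ j)"
    by (rule sum.swap)
  also have "\<dots> = trace (transpose A ** B)"
    by (simp add: trace_def matrix_matrix_mult_def transpose_def)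
  finally show ?thesis .
qed

section \<open>The Euclidean space of symmetric matrices\<close>

typedef (overloaded) ('n::finite) sym_mat = "{X :: real^'n^'n. transpose X = X}"
  morphisms mat_of Sym
  by (rule exI[of _ "mat 1"]) (simp add: transpose_mat)

setup_lifting type_definition_sym_mat

lemma mat_of_nth_sym: "mat_of X $ i $ j = mat_of X $ j $ i"
proof -
  have "transpose (mat_of X) $ j $ i = mat_of X $ j $ i"
    using mat_of[of X] by simp
  then show ?thesis
    by (simp add: transpose_def)
qed

instantiation sym_mat :: (finite) real_vector
begin

lift_definition zero_sym_mat :: "'a sym_mat" is 0
  by (simp add: transpose_def vec_eq_iff)

lift_definition plus_sym_mat :: "'a sym_mat \<Rightarrow> 'a sym_mat \<Rightarrow> 'a sym_mat" is "(+)"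
  by (simp add: transpose_def vec_eq_iff)

lift_definition minus_sym_mat :: "'a sym_mat \<Rightarrow> 'a sym_mat \<Rightarrow> 'a sym_mat" is "(-)"
  by (simp add: transpose_def vec_eq_iff)

lift_definition uminus_sym_mat :: "'a sym_mat \<Rightarrow> 'a sym_mat" is uminus
  by (simp add: transpose_def vec_eq_iff)

lift_definition scaleR_sym_mat :: "real \<Rightarrow> 'a sym_mat \<Rightarrow> 'a sym_mat" is "(*\<^sub>R)"
  by (simp add: transpose_def vec_eq_iff)

instance
proof
  fix X Y Z :: "'a sym_mat" and r s :: real
  show "X + Y + Z = X + (Y + Z)" by transfer simp
  show "X + Y = Y + X" by transfer simp
  show "0 + X = X" by transfer simp
  show "- X + X = 0" by transfer simp
  show "X - Y = X + - Y" by transfer simp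
  show "r *\<^sub>R (X + Y) = r *\<^sub>R X + r *\<^sub>R Y" by transfer (simp add: scaleR_add_right)
  show "(r + s) *\<^sub>R X = r *\<^sub>R X + s *\<^sub>R X" by transfer (simp add: scaleR_add_left)
  show "r *\<^sub>R s *\<^sub>R X = (r * s) *\<^sub>R X" by transfer simp
  show "1 *\<^sub>R X = X" by transfer simp
qed

end

instantiation sym_mat :: (finite) real_inner
begin

definition inner_sym_mat :: "'a sym_mat \<Rightarrow> 'a sym_mat \<Rightarrow> real"
  where "inner_sym_mat X Y = mat_of X \<bullet> mat_of Y"

definition norm_sym_mat :: "'a sym_mat \<Rightarrow> real"
  where "norm_sym_mat X = norm (mat_of X)"

definition dist_sym_mat :: "'a sym_mat \<Rightarrow> 'a sym_mat \<Rightarrow> real"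
  where "dist_sym_mat X Y = norm (X - Y)"

definition sgn_sym_mat :: "'a sym_mat \<Rightarrow> 'a sym_mat"
  where "sgn_sym_mat X = X /\<^sub>R norm X"

definition uniformity_sym_mat :: "('a sym_mat \<times> 'a sym_mat) filter"
  where "uniformity_sym_mat = (INF e\<in>{0 <..}. principal {(x, y). dist x y < e})"

definition open_sym_mat :: "'a sym_mat set \<Rightarrow> bool"
  where "open_sym_mat U \<longleftrightarrow>
    (\<forall>x\<in>U. eventually (\<lambda>(x', y). x' = x \<longrightarrow> y \<in> U) uniformity)"

instance
proof
  fix X Y Z :: "'a sym_mat" and r :: real
  show "dist X Y = norm (X - Y)" by (rule dist_sym_mat_def)
  show "sgn X = X /\<^sub>R norm X" by (rule sgn_sym_mat_def)
  show "(uniformity :: ('a sym_mat \<times> 'a sym_mat) filter) =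
      (INF e\<in>{0 <..}. principal {(x, y). dist x y < e})"
    by (rule uniformity_sym_mat_def)
  show "open U \<longleftrightarrow> (\<forall>x\<in>U. eventually (\<lambda>(x', y). x' = x \<longrightarrow> y \<in> U) uniformity)"
    for U :: "'a sym_mat set"
    by (rule open_sym_mat_def)
  show "X \<bullet> Y = Y \<bullet> X" by (simp add: inner_sym_mat_def inner_commute)
  show "(X + Y) \<bullet> Z = X \<bullet> Z + Y \<bullet> Z"
    by (simp add: inner_sym_mat_def plus_sym_mat.rep_eq inner_add_left)
  show "(r *\<^sub>R X) \<bullet> Y = r * (X \<bullet> Y)"
    by (simp add: inner_sym_mat_def scaleR_sym_mat.rep_eq)
  show "0 \<le> X \<bullet> X" by (simp add: inner_sym_mat_def)
  show "X \<bullet> X = 0 \<longleftrightarrow> X = 0"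
    by (simp add: inner_sym_mat_def mat_of_inject[symmetric] zero_sym_mat.rep_eq)
  show "norm X = sqrt (X \<bullet> X)"
    by (simp add: inner_sym_mat_def norm_sym_mat_def norm_eq_sqrt_inner)
qed

end

text \<open>
  The standard orthonormal basis: \<open>E\<^sub>i\<^sub>i\<close> and, for \<open>i \<noteq> j\<close>, \<open>(E\<^sub>i\<^sub>j + E\<^sub>j\<^sub>i) / \<surd>2\<close>.
\<close>

lift_definition sym_unit :: "'n \<Rightarrow> 'n \<Rightarrow> 'n::finite sym_mat" is
  "\<lambda>i j. \<chi> k l. if i = j then of_bool (k = i \<and> l = i)
                 else of_bool (k = i \<and> l = j \<or> k = j \<and> l = i) / sqrt 2"
  by (auto simp: transpose_def vec_eq_iff)

lemma sym_unit_commute: "sym_unit i j = sym_unit j i"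
  by (simp add: mat_of_inject[symmetric] sym_unit.rep_eq vec_eq_iff)

lemma inner_sym_unit:
  "X \<bullet> sym_unit i j = (if i = j then mat_of X $ i $ i else sqrt 2 * mat_of X $ i $ j)"
proof (cases "i = j")
  case True
  have "X \<bullet> sym_unit i j = (\<Sum>k\<in>UNIV. \<Sum>l\<in>UNIV. mat_of X $ k $ l * of_bool (k = i \<and> l = i))"
    using True by (simp add: inner_sym_mat_def inner_vec_def sym_unit.rep_eq)
  also have "\<dots> = (\<Sum>k\<in>UNIV. \<Sum>l\<in>UNIV. if l = i then if k = i then mat_of X $ k $ l else 0 else 0)"
    by (intro sum.cong) auto
  also have "\<dots> = mat_of X $ i $ i"
    by simp
  finally show ?thesis
    using True by simp
next
  case False
  have "X \<bullet> sym_unit i j =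
      (\<Sum>k\<in>UNIV. \<Sum>l\<in>UNIV. mat_of X $ k $ l * (of_bool (k = i \<and> l = j \<or> k = j \<and> l = i) / sqrt 2))"
    using False by (simp add: inner_sym_mat_def inner_vec_def sym_unit.rep_eq)
  also have "\<dots> = (\<Sum>k\<in>UNIV. \<Sum>l\<in>UNIV.
      (if l = j then if k = i then mat_of X $ k $ l / sqrt 2 else 0 else 0)
      + (if l = i then if k = j then mat_of X $ k $ l / sqrt 2 else 0 else 0))"
    using False by (intro sum.cong) auto
  also have "\<dots> = mat_of X $ i $ j / sqrt 2 + mat_of X $ j $ i / sqrt 2"
    by (simp add: sum.distrib)
  also have "\<dots> = sqrt 2 * mat_of X $ i $ j"
    by (simp add: mat_of_nth_sym[of X j i] field_simps)
  finally show ?thesis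
    using False by simp
qed

instantiation sym_mat :: (finite) euclidean_space
begin

definition Basis_sym_mat :: "'a sym_mat set"
  where "Basis_sym_mat = {sym_unit i j | i j. True}"

instance
proof
  have *: "(Basis :: 'a sym_mat set) = (\<lambda>(i, j). sym_unit i j) ` UNIV"
    by (auto simp: Basis_sym_mat_def image_iff)
  show "finite (Basis :: 'a sym_mat set)"
    unfolding * by (rule finite_imageI) (rule finite)
  show "(Basis :: 'a sym_mat set) \<noteq> {}"
    unfolding * by blast
next
  fix u v :: "'a sym_mat"
  assume "u \<in> Basis" "v \<in> Basis"
  then obtain i j k l where u: "u = sym_unit i j" and v: "v = sym_unit k l"
    by (auto simp: Basis_sym_mat_def)
  show "u \<bullet> v = (if u = v then 1 else 0)"
  proof (cases "k = i \<and> l = j \<or> k = j \<and> l = i")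
    case True
    then have "v = u" using sym_unit_commute u v by auto
    moreover have "u \<bullet> u = 1"
      unfolding u inner_sym_unit by (simp add: sym_unit.rep_eq)
    ultimately show ?thesis by simp
  next
    case False
    have 0: "u \<bullet> v = 0"
      unfolding u v inner_sym_unit using False by (auto simp: sym_unit.rep_eq)
    moreover have "v \<bullet> v = 1"
      unfolding v inner_sym_unit by (simp add: sym_unit.rep_eq)
    ultimately show ?thesis by auto
  qed
next
  fix X :: "'a sym_mat"
  have "X = 0" if "\<forall>u\<in>Basis. X \<bullet> u = 0"
  proof -
    have "mat_of X $ i $ j = 0" for i j
    proof -
      have "X \<bullet> sym_unit i j = 0" using that by (auto simp: Basis_sym_mat_def)
      then show ?thesis by (auto simp: inner_sym_unit split: if_splits)
    qed
    then show ?thesis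
      by (simp add: mat_of_inject[symmetric] zero_sym_mat.rep_eq vec_eq_iff)
  qed
  then show "(\<forall>u\<in>Basis. X \<bullet> u = 0) \<longleftrightarrow> X = 0" by auto
qed

end

section \<open>Semidefinite programs and approximately critical pairs\<close>

definition tau :: "nat \<Rightarrow> nat"
  where "tau k = (k + 1) choose 2"

definition psd :: "real^'n^'n \<Rightarrow> bool"
  where "psd X \<longleftrightarrow> transpose X = X \<and> (\<forall>v. 0 \<le> v \<bullet> (X *v v))"

definition calA :: "('m::finite \<Rightarrow> 'n::finite sym_mat) \<Rightarrow> real^'n^'n \<Rightarrow> real^'m"
  where "calA A X = (\<chi> i. mat_of (A i) \<bullet> X)"

definition norm_calA :: "('m::finite \<Rightarrow> 'n::finite sym_mat) \<Rightarrow> real"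
  where "norm_calA A = onorm (\<lambda>X :: 'n sym_mat. calA A (mat_of X))"

definition calA_adj :: "('m::finite \<Rightarrow> 'n::finite sym_mat) \<Rightarrow> real^'m \<Rightarrow> 'n sym_mat"
  where "calA_adj A lam = (\<Sum>i\<in>UNIV. (lam $ i) *\<^sub>R A i)"

definition slack :: "('m::finite \<Rightarrow> 'n::finite sym_mat) \<Rightarrow> 'n sym_mat \<Rightarrow> real^'m \<Rightarrow> real^'n^'n"
  where "slack A C lam = mat_of (C - calA_adj A lam)"

definition approx_optimal ::
  "('m::finite \<Rightarrow> 'n::finite sym_mat) \<Rightarrow> real^'m \<Rightarrow> 'n sym_mat \<Rightarrow> real \<Rightarrow> real \<Rightarrow> real
    \<Rightarrow> real^'n^'n \<Rightarrow> real^'m \<Rightarrow> bool"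
  where "approx_optimal A b C \<epsilon>0 \<epsilon>1 \<epsilon>2 X lam \<longleftrightarrow>
    norm (calA A X - b) \<le> \<epsilon>0 \<and>
    norm (slack A C lam ** X) \<le> \<epsilon>1 \<and>
    psd X \<and>
    psd (slack A C lam + \<epsilon>2 *\<^sub>R mat 1)"

definition AFAC ::
  "('m::finite \<Rightarrow> 'n::finite sym_mat) \<Rightarrow> real^'m \<Rightarrow> 'n sym_mat \<Rightarrow> real \<Rightarrow> real \<Rightarrow> real \<Rightarrow> real
    \<Rightarrow> real^'p^'n \<Rightarrow> real^'m \<Rightarrow> bool"
  where "AFAC A b C \<epsilon>0 \<epsilon>1 \<epsilon>2 \<gamma> Y lam \<longleftrightarrow>
    norm (calA A (Y ** transpose Y) - b) \<le> \<epsilon>0 \<and>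
    norm (slack A C lam ** Y) \<le> \<epsilon>1 \<and>
    (\<forall>U :: real^'p^'n. norm U = 1 \<and> norm (calA A (U ** transpose Y)) \<le> \<gamma> \<longrightarrow>
       slack A C lam \<bullet> (U ** transpose U) \<ge> - \<epsilon>2)"

definition spurious_AFAC ::
  "('m::finite \<Rightarrow> 'n::finite sym_mat) \<Rightarrow> real^'m \<Rightarrow> 'n sym_mat \<Rightarrow> real \<Rightarrow> real
    \<Rightarrow> real \<Rightarrow> real \<Rightarrow> real \<Rightarrow> real \<Rightarrow> real^'p^'n \<Rightarrow> real^'m \<Rightarrow> bool"
  where "spurious_AFAC A b C R_Y R_lam \<epsilon>0 \<epsilon>1 \<epsilon>2 \<gamma> Y lam \<longleftrightarrow>
    AFAC A b C \<epsilon>0 \<epsilon>1 \<epsilon>2 \<gamma> Y lam \<and>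
    \<not> approx_optimal A b C \<epsilon>0 (R_Y * \<epsilon>1) \<epsilon>2 (Y ** transpose Y) lam \<and>
    norm Y \<le> R_Y \<and> norm lam \<le> R_lam"

text \<open>The type argument fixes the number of columns \<open>p\<close> of the factor \<open>Y\<close>.\<close>

definition spurious_costs ::
  "('p::finite) itself \<Rightarrow> ('m::finite \<Rightarrow> 'n::finite sym_mat) \<Rightarrow> real^'m \<Rightarrow> real \<Rightarrow> real
    \<Rightarrow> real \<Rightarrow> real \<Rightarrow> real \<Rightarrow> real \<Rightarrow> 'n sym_mat set"
  where "spurious_costs _ A b R_Y R_lam \<epsilon>0 \<epsilon>1 \<epsilon>2 \<gamma> =
    {C. \<exists>(Y :: real^'p^'n) lam. spurious_AFAC A b C R_Y R_lam \<epsilon>0 \<epsilon>1 \<epsilon>2 \<gamma> Y lam}"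

end

theory Submission
  imports Defs
begin

text \<open>
  If \<open>Y\<close> is nearly singular, in the sense that \<open>\<parallel>Y z\<parallel> \<le> \<gamma> / \<parallel>A\<parallel>\<close> for a unit vector \<open>z\<close>, then every
  \<open>x z\<^sup>T\<close> is an admissible second-order direction, \<open>S(\<lambda>) \<succeq> - \<epsilon>2 I\<close>, and the pair is not spurious.
  For a spurious pair, \<open>S(\<lambda>) Y\<close> being small therefore forces \<open>S(\<lambda>) Z\<close> to be small for a frame
  \<open>Z\<close> obtained by normalising \<open>Y\<close> on \<open>p\<close> of its rows, with entries bounded by 1.  Replacing \<open>\<lambda>\<close> by
  a point of a finite net and fixing the \<open>p\<close> rows, such a cost matrix \<open>C\<close> is confined by all its
  entries outside the corresponding \<open>p \<times> p\<close> block: the block varies in a set of diameter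
  \<open>4 n p \<delta>\<close>.  A set that is thin in \<open>\<tau>(p)\<close> coordinate directions has small volume, because many
  translates of a rescaled copy of it fit disjointly into the ball.  The union bound over the net and
  over the choices of rows gives the estimate.
\<close>

section \<open>Packings and thin slices\<close>

lemma measure_lborel_cball:
  fixes c :: "'a::euclidean_space"
  assumes "0 \<le> r"
  shows "measure lborel (cball c r) = unit_ball_vol DIM('a) * r ^ DIM('a)"
  using content_cball[OF assms, of c] by simp

text \<open>Balls of radius \<open>r / 2\<close> about the points of \<open>F\<close> are disjoint
  and lie in the ball of radius \<open>R + r / 2\<close>; compare volumes.\<close>

lemma separated_card_le:
  fixes F :: "'a::euclidean_space set"
  assumes "0 < r" and "0 \<le> R" and F: "finite F" "F \<subseteq> cball 0 R" "pairwise (\<lambda>x y. r < dist x y) F"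
  shows "real (card F) \<le> (1 + 2 * R / r) ^ DIM('a)"
proof -
  let ?V = "unit_ball_vol (real DIM('a))"
  have disj: "disjoint_family_on (\<lambda>x. cball x (r / 2)) F"
    unfolding disjoint_family_on_def
  proof (intro ballI impI)
    fix x y assume "x \<in> F" "y \<in> F" "x \<noteq> y"
    then have "r < dist x y" using F(3) by (auto simp: pairwise_def)
    then show "cball x (r / 2) \<inter> cball y (r / 2) = {}"
      by (intro disjoint_cballI) simp
  qed
  have "real (card F) * (?V * (r / 2) ^ DIM('a)) = (\<Sum>x\<in>F. measure lborel (cball x (r / 2)))"
    using assms(1) by (simp add: measure_lborel_cball)
  also have "\<dots> = measure lborel (\<Union>x\<in>F. cball x (r / 2))"
    using F(1) disj by (intro measure_finite_Union[symmetric]) (auto simp: emeasure_cball less_imp_le assms(1))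
  also have "\<dots> \<le> measure lborel (cball (0::'a) (R + r / 2))"
  proof (rule measure_mono_fmeasurable)
    show "(\<Union>x\<in>F. cball x (r / 2)) \<subseteq> cball 0 (R + r / 2)"
    proof
      fix y assume "y \<in> (\<Union>x\<in>F. cball x (r / 2))"
      then obtain x where "x \<in> F" "dist x y \<le> r / 2" by auto
      then show "y \<in> cball 0 (R + r / 2)"
        using F(2) dist_triangle[of 0 y x] by force
    qed
  qed (use F(1) in \<open>auto intro: fmeasurable_compact\<close>)
  also have "\<dots> = ?V * (R + r / 2) ^ DIM('a)"
    using assms by (simp add: measure_lborel_cball)
  also have "R + r / 2 = (1 + 2 * R / r) * (r / 2)"
    using assms(1) by (simp add: field_simps)
  finally have "real (card F) * (?V * (r / 2) ^ DIM('a)) \<le> (1 + 2 * R / r) ^ DIM('a) * (?V * (r / 2) ^ DIM('a))"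
    by (simp only: power_mult_distrib mult_ac)
  moreover have "0 < ?V * (r / 2) ^ DIM('a)" using assms(1) by simp
  ultimately show ?thesis by (simp only: mult_le_cancel_right_pos)
qed

lemma covering_card_ge:
  fixes F :: "'a::euclidean_space set"
  assumes "0 < r" and "0 \<le> R" and F: "finite F" "cball 0 R \<subseteq> (\<Union>x\<in>F. cball x r)"
  shows "(R / r) ^ DIM('a) \<le> real (card F)"
proof -
  let ?V = "unit_ball_vol (real DIM('a))"
  have "?V * R ^ DIM('a) = measure lborel (cball (0::'a) R)"
    using assms by (simp add: measure_lborel_cball)
  also have "\<dots> \<le> measure lborel (\<Union>x\<in>F. cball x r)"
    using F by (intro measure_mono_fmeasurable) (auto intro!: fmeasurable.finite_UN fmeasurable_compact)
  also have "\<dots> \<le> (\<Sum>x\<in>F. measure lborel (cball x r))"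
    using F(1) by (intro measure_UNION_le) auto
  also have "\<dots> = real (card F) * (?V * r ^ DIM('a))"
    using assms(1) by (simp add: measure_lborel_cball)
  finally have "?V * R ^ DIM('a) \<le> ?V * (real (card F) * r ^ DIM('a))"
    by (simp add: mult_ac)
  then have "R ^ DIM('a) \<le> real (card F) * r ^ DIM('a)"
    by simp
  then show ?thesis using assms(1) by (simp add: power_divide field_simps)
qed

text \<open>The packing bound makes a separated set of greatest cardinality exist, and since no
  point can be added to it, it covers the ball. The lower bound on its size later counts disjoint
  translates, the upper bound the points of a net of multipliers.\<close>

lemma maximal_separated_set:
  fixes r R :: real
  assumes "0 < r" and "0 \<le> R"
  obtains F :: "'a::euclidean_space set"
  where "finite F" "F \<subseteq> cball 0 R" "pairwise (\<lambda>x y. r < dist x y) F"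
    "cball 0 R \<subseteq> (\<Union>x\<in>F. cball x r)"
    "(R / r) ^ DIM('a) \<le> real (card F)" "real (card F) \<le> (1 + 2 * R / r) ^ DIM('a)"
proof -
  define P where "P F \<longleftrightarrow> finite F \<and> F \<subseteq> cball 0 R \<and> pairwise (\<lambda>x y. r < dist x y) F" for F :: "'a set"
  have "P {}" by (simp add: P_def)
  moreover have "\<forall>F. P F \<longrightarrow> card F < Suc (nat \<lfloor>(1 + 2 * R / r) ^ DIM('a)\<rfloor>)"
  proof (intro allI impI)
    fix F assume "P F"
    then have "real (card F) \<le> (1 + 2 * R / r) ^ DIM('a)"
      using separated_card_le[OF assms] by (auto simp: P_def)
    then show "card F < Suc (nat \<lfloor>(1 + 2 * R / r) ^ DIM('a)\<rfloor>)" by linarith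
  qed
  ultimately obtain F where F: "P F" and max: "\<And>G. P G \<Longrightarrow> card G \<le> card F"
    using ex_has_greatest_nat[of P "{}" card] by metis
  have cover: "cball 0 R \<subseteq> (\<Union>x\<in>F. cball x r)"
  proof (rule ccontr)
    assume "\<not> ?thesis"
    then obtain y where y: "y \<in> cball 0 R" "\<And>x. x \<in> F \<Longrightarrow> r < dist x y" by force
    then have "y \<notin> F" using assms(1) by fastforce
    moreover have "P (insert y F)"
      using F y by (auto simp: P_def pairwise_insert dist_commute)
    ultimately show False
      using max[of "insert y F"] F by (auto simp: P_def)
  qed
  show thesis
    using F cover separated_card_le[OF assms] covering_card_ge[OF assms]
    by (intro that[of F]) (auto simp: P_def)
qed

text \<open>Change of variables. Compactness of \<open>X\<close> makes the image Borel, and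
  injectivity of \<open>T\<close> makes its preimage \<open>X\<close> again.\<close>

lemma measure_diagonal_affine_image:
  fixes g :: "'a::euclidean_space \<Rightarrow> real" and t :: 'a
  assumes "compact X" and g: "\<And>j. j \<in> Basis \<Longrightarrow> g j \<noteq> 0"
  defines "T x \<equiv> t + (\<Sum>j\<in>Basis. (g j * (x \<bullet> j)) *\<^sub>R j)"
  shows "measure lborel (T ` X) = (\<Prod>j\<in>Basis. \<bar>g j\<bar>) * measure lborel X"
proof -
  have cont: "continuous_on UNIV T" unfolding T_def by (intro continuous_intros)
  then have [measurable]: "T \<in> borel \<rightarrow>\<^sub>M borel" by (rule borel_measurable_continuous_onI)
  have "compact (T ` X)"
    using assms(1) cont continuous_on_subset by (blast intro: compact_continuous_image)
  then have [measurable]: "T ` X \<in> sets borel" by (intro borel_compact)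
  have inj: "T x = T y \<longleftrightarrow> x = y" for x y
  proof
    assume "T x = T y"
    have "x \<bullet> j = y \<bullet> j" if "j \<in> Basis" for j
    proof -
      have "T x \<bullet> j = T y \<bullet> j" using \<open>T x = T y\<close> by simp
      then show ?thesis using that g[OF that]
        by (simp add: T_def inner_add_left inner_sum_left_Basis)
    qed
    then show "x = y" by (rule euclidean_eqI)
  qed simp
  have "emeasure lborel (T ` X)
      = emeasure (density (distr lborel borel T) (\<lambda>_. (\<Prod>j\<in>Basis. \<bar>g j\<bar>))) (T ` X)"
    using lborel_affine_euclidean[of g t] g unfolding T_def by simp
  also have "\<dots> = ennreal (\<Prod>j\<in>Basis. \<bar>g j\<bar>) * emeasure lborel (T -` T ` X)"
    by (simp add: emeasure_density nn_integral_cmult_indicator emeasure_distr)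
  also have "T -` T ` X = X" using inj by auto
  finally show ?thesis
    by (simp add: measure_def enn2real_mult prod_nonneg)
qed

text \<open>Shrink \<open>X\<close> about \<open>c\<close> by \<open>a\<close> along
  \<open>J\<close> and by \<open>q\<close> along the other axes, then translate along the span of
  \<open>J\<close> by an \<open>a * d\<close>-separated family. Two copies that meet come from
  points of \<open>X\<close> agreeing off \<open>J\<close>, hence within \<open>d\<close>, so their
  translations are within \<open>a * d\<close> and equal. The type \<open>'b\<close> only serves as
  a Euclidean space of dimension \<open>card J\<close> in which to pack.\<close>

lemma measure_thin_slices_aux:
  fixes X :: "'a::euclidean_space set" and c :: 'a
  assumes X: "compact X" "X \<subseteq> cball c \<sigma>" and "0 < \<sigma>" and "0 < d"
    and J: "J \<subseteq> Basis" "card J = DIM('b::euclidean_space)"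
    and thin: "\<And>x y. \<lbrakk>x \<in> X; y \<in> X; \<And>i. i \<in> Basis - J \<Longrightarrow> x \<bullet> i = y \<bullet> i\<rbrakk> \<Longrightarrow> dist x y \<le> d"
    and "0 < a" "0 \<le> s" "0 < q" and budget: "(s + a * \<sigma>)\<^sup>2 + (q * \<sigma>)\<^sup>2 \<le> \<sigma>\<^sup>2"
  shows "measure lborel X * (q ^ (DIM('a) - DIM('b)) * (s / d) ^ DIM('b)) \<le> measure lborel (cball c \<sigma>)"
proof -
  obtain \<phi> :: "'b \<Rightarrow> 'a" where \<phi>: "bij_betw \<phi> Basis J"
    using J finite_subset[OF J(1)] by (metis finite_Basis finite_same_card_bij)
  then have \<phi>_Basis: "\<phi> u \<in> Basis" "\<phi> u \<in> J" if "u \<in> Basis" for u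
    using that J(1) by (auto simp: bij_betw_def)
  \<comment> \<open>\<open>h\<close> embeds \<open>'b\<close> isometrically as the span of
    \<open>J\<close>; \<open>P\<close> is the orthogonal projection onto that span.\<close>
  define h where "h w = (\<Sum>u\<in>Basis. (w \<bullet> u) *\<^sub>R \<phi> u)" for w
  define P where "P x = (\<Sum>i\<in>J. (x \<bullet> i) *\<^sub>R i)" for x :: 'a
  define g where "g i = (if i \<in> J then a else q)" for i
  have finJ: "finite J" using J(1) finite_Basis finite_subset by blast
  have P_inner: "P x \<bullet> i = (if i \<in> J then x \<bullet> i else 0)" if "i \<in> Basis" for x i
    using that J(1) finJ by (auto simp: P_def inner_sum_left inner_Basis subset_iff if_distrib cong: if_cong)
  have h_inner: "h w \<bullet> i = 0" if "i \<in> Basis" "i \<notin> J" for w i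
    using that \<phi>_Basis by (auto simp: h_def inner_sum_left inner_Basis intro!: sum.neutral)
  have h_diff: "h w - h v = h (w - v)" for w v
    by (simp add: h_def inner_diff_left scaleR_left_diff_distrib sum_subtractf)
  have norm_h: "norm (h w) = norm w" for w
  proof -
    have "h w \<bullet> \<phi> u = w \<bullet> u" if "u \<in> Basis" for u
    proof -
      have "h w \<bullet> \<phi> u = (\<Sum>v\<in>Basis. (w \<bullet> v) * of_bool (v = u))"
        unfolding h_def inner_sum_left
      proof (rule sum.cong)
        fix v :: 'b assume v: "v \<in> Basis"
        have "\<phi> v = \<phi> u \<longleftrightarrow> v = u" using \<phi> v that by (auto simp: bij_betw_def inj_on_def)
        then show "((w \<bullet> v) *\<^sub>R \<phi> v) \<bullet> \<phi> u = (w \<bullet> v) * of_bool (v = u)"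
          using \<phi>_Basis v that by (auto simp: inner_Basis)
      qed simp
      then show ?thesis using that by simp
    qed
    then have "h w \<bullet> h w = (\<Sum>u\<in>Basis. (w \<bullet> u) * (w \<bullet> u))"
      by (subst (2) h_def) (simp add: inner_sum_right)
    then show ?thesis by (simp add: norm_eq_sqrt_inner euclidean_inner[of w w])
  qed
  define E where "E w x = h w + c + (\<Sum>i\<in>Basis. (g i * ((x - c) \<bullet> i)) *\<^sub>R i)" for w x
  have E_inner: "E w x \<bullet> i = h w \<bullet> i + c \<bullet> i + g i * ((x - c) \<bullet> i)" if "i \<in> Basis" for w x i
    using that by (simp add: E_def inner_add_left inner_sum_left_Basis)
  have E_alt: "E w x = h w + c + a *\<^sub>R P (x - c) + q *\<^sub>R ((x - c) - P (x - c))" for w x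
    by (rule euclidean_eqI)
      (simp add: E_inner inner_add_left inner_diff_left P_inner g_def)
  obtain F :: "'b set" where F: "finite F" "F \<subseteq> cball 0 s" "pairwise (\<lambda>x y. a * d < dist x y) F"
    "(s / (a * d)) ^ DIM('b) \<le> real (card F)"
    using maximal_separated_set[of "a * d" s] assms by (metis mult_pos_pos)
  \<comment> \<open>Pythagoras: the component along \<open>J\<close> has length at most
    \<open>s + a * \<sigma>\<close>, the one orthogonal to it at most \<open>q * \<sigma>\<close>,
    and the hypothesis \<open>budget\<close> says that these fit into the ball.\<close>
  have E_sub: "E w ` X \<subseteq> cball c \<sigma>" if "w \<in> F" for w
  proof
    fix y assume "y \<in> E w ` X"
    then obtain x where x: "x \<in> X" "y = E w x" by blast
    define u where "u = P (x - c)"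
    define v where "v = (x - c) - u"
    have uv: "u \<bullet> v = 0"
    proof -
      have "u \<bullet> v = (\<Sum>i\<in>Basis. (u \<bullet> i) * (v \<bullet> i))" by (rule euclidean_inner)
      also have "\<dots> = 0"
        by (intro sum.neutral) (auto simp: u_def v_def P_inner inner_diff_left)
      finally show ?thesis .
    qed
    have hv: "h w \<bullet> v = 0"
    proof -
      have "h w \<bullet> v = (\<Sum>i\<in>Basis. (h w \<bullet> i) * (v \<bullet> i))" by (rule euclidean_inner)
      also have "\<dots> = 0"
        by (intro sum.neutral) (auto simp: u_def v_def P_inner h_inner inner_diff_left)
      finally show ?thesis .
    qed
    have "(norm u)\<^sup>2 + (norm v)\<^sup>2 = (norm (x - c))\<^sup>2"
      using norm_add_Pythagorean[of u v] uv by (simp add: orthogonal_def v_def)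
    moreover have xc: "norm (x - c) \<le> \<sigma>" using X(2) x(1) by (auto simp: dist_norm norm_minus_commute)
    ultimately have uv2: "(norm u)\<^sup>2 + (norm v)\<^sup>2 \<le> \<sigma>\<^sup>2"
      by (metis norm_ge_zero power_mono)
    then have "(norm u)\<^sup>2 \<le> \<sigma>\<^sup>2" "(norm v)\<^sup>2 \<le> \<sigma>\<^sup>2"
      using zero_le_power2[of "norm u"] zero_le_power2[of "norm v"] by linarith+
    then have nu: "norm u \<le> \<sigma>" and nv: "norm v \<le> \<sigma>"
      using assms(3) by (auto intro: power2_le_imp_le)
    have "norm (h w + a *\<^sub>R u) \<le> norm w + a * norm u"
      using norm_triangle_ineq[of "h w" "a *\<^sub>R u"] \<open>0 < a\<close> by (simp add: norm_h)
    also have "\<dots> \<le> s + a * \<sigma>"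
      using F(2) that nu \<open>0 < a\<close> by (intro add_mono mult_left_mono) auto
    finally have 1: "(norm (h w + a *\<^sub>R u))\<^sup>2 \<le> (s + a * \<sigma>)\<^sup>2"
      by (intro power_mono) auto
    have 2: "(norm (q *\<^sub>R v))\<^sup>2 \<le> (q * \<sigma>)\<^sup>2"
      using nv \<open>0 < q\<close> by (intro power_mono) auto
    have "y - c = (h w + a *\<^sub>R u) + q *\<^sub>R v"
      unfolding x(2) E_alt u_def v_def by simp
    moreover have "orthogonal (h w + a *\<^sub>R u) (q *\<^sub>R v)"
      using uv hv by (simp add: orthogonal_def inner_add_left)
    ultimately have "(norm (y - c))\<^sup>2 = (norm (h w + a *\<^sub>R u))\<^sup>2 + (norm (q *\<^sub>R v))\<^sup>2"
      using norm_add_Pythagorean by metis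
    also have "\<dots> \<le> \<sigma>\<^sup>2" using 1 2 budget by linarith
    finally have "norm (y - c) \<le> \<sigma>" using assms(3) by (auto intro: power2_le_imp_le)
    then show "y \<in> cball c \<sigma>" by (simp add: dist_norm norm_minus_commute)
  qed
  have E_image: "E w ` X = (\<lambda>x. (h w + c - (\<Sum>i\<in>Basis. (g i * (c \<bullet> i)) *\<^sub>R i))
      + (\<Sum>i\<in>Basis. (g i * (x \<bullet> i)) *\<^sub>R i)) ` X" for w
    unfolding E_def
    by (intro image_cong refl)
      (simp add: inner_diff_left right_diff_distrib scaleR_left_diff_distrib sum_subtractf)
  have g_pos: "0 < g i" for i using \<open>0 < a\<close> \<open>0 < q\<close> by (simp add: g_def)
  have g_prod: "(\<Prod>i\<in>Basis. \<bar>g i\<bar>) = a ^ DIM('b) * q ^ (DIM('a) - DIM('b))"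
  proof -
    have "(\<Prod>i\<in>Basis. \<bar>g i\<bar>) = (\<Prod>i\<in>Basis - J. \<bar>g i\<bar>) * (\<Prod>i\<in>J. \<bar>g i\<bar>)"
      using J(1) by (intro prod.subset_diff) auto
    also have "(\<Prod>i\<in>J. \<bar>g i\<bar>) = a ^ DIM('b)"
      using \<open>0 < a\<close> J(2) by (simp add: g_def)
    also have "(\<Prod>i\<in>Basis - J. \<bar>g i\<bar>) = q ^ (DIM('a) - DIM('b))"
      using \<open>0 < q\<close> J finJ by (simp add: g_def card_Diff_subset)
    finally show ?thesis by simp
  qed
  have E_measure: "measure lborel (E w ` X) = a ^ DIM('b) * q ^ (DIM('a) - DIM('b)) * measure lborel X" for w
    using measure_diagonal_affine_image[OF X(1), of g] g_pos
    by (simp add: E_image g_prod less_imp_neq[symmetric])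
  have E_compact: "compact (E w ` X)" for w
    using X(1) by (intro compact_continuous_image) (auto simp: E_def intro!: continuous_intros)
  have disj: "disjoint_family_on (\<lambda>w. E w ` X) F"
    unfolding disjoint_family_on_def
  proof (intro ballI impI equals0I)
    fix w v y assume wv: "w \<in> F" "v \<in> F" "w \<noteq> v" and "y \<in> E w ` X \<inter> E v ` X"
    then obtain x x' where x: "x \<in> X" "x' \<in> X" and eq: "E w x = E v x'" by auto
    have off: "x \<bullet> i = x' \<bullet> i" if "i \<in> Basis - J" for i
    proof -
      have "E w x \<bullet> i = E v x' \<bullet> i" using eq by simp
      then show ?thesis
        using that \<open>0 < q\<close> by (simp add: E_inner h_inner g_def inner_diff_left)
    qed
    have "h (w - v) = a *\<^sub>R (x' - x)"
    proof (rule euclidean_eqI)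
      fix i :: 'a assume i: "i \<in> Basis"
      have "E w x \<bullet> i = E v x' \<bullet> i" using eq by simp
      then have "h w \<bullet> i + g i * (x \<bullet> i) = h v \<bullet> i + g i * (x' \<bullet> i)"
        using i by (simp add: E_inner inner_diff_left right_diff_distrib)
      then show "h (w - v) \<bullet> i = a *\<^sub>R (x' - x) \<bullet> i"
        using i off[of i]
        by (cases "i \<in> J") (auto simp: h_diff[symmetric] inner_diff_left g_def h_inner right_diff_distrib)
    qed
    then have "norm (w - v) = a * dist x' x"
      using norm_h[of "w - v"] \<open>0 < a\<close> by (simp add: dist_norm)
    also have "\<dots> \<le> a * d"
      using thin[OF x(2,1)] off \<open>0 < a\<close> by (intro mult_left_mono) auto
    finally have "dist w v \<le> a * d" by (simp add: dist_norm)
    moreover have "a * d < dist w v" using F(3) wv by (simp add: pairwise_def)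
    ultimately show False by simp
  qed
  \<comment> \<open>The number of copies grows like \<open>1 / a ^ DIM('b)\<close> while the volume
    of each carries the factor \<open>a ^ DIM('b)\<close>, so \<open>a\<close> cancels.\<close>
  have "measure lborel X * (q ^ (DIM('a) - DIM('b)) * (s / d) ^ DIM('b))
      = (s / (a * d)) ^ DIM('b) * (a ^ DIM('b) * q ^ (DIM('a) - DIM('b)) * measure lborel X)"
    using \<open>0 < a\<close> by (simp add: power_divide power_mult_distrib)
  also have "\<dots> \<le> real (card F) * (a ^ DIM('b) * q ^ (DIM('a) - DIM('b)) * measure lborel X)"
    using F(4) \<open>0 < a\<close> \<open>0 < q\<close> by (intro mult_right_mono) auto
  also have "\<dots> = (\<Sum>w\<in>F. measure lborel (E w ` X))" by (simp add: E_measure)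
  also have "\<dots> = measure lborel (\<Union>w\<in>F. E w ` X)"
    using F(1) disj E_compact
    by (intro measure_finite_Union[symmetric])
      (auto intro: borel_compact simp: emeasure_compact_finite[OF E_compact, THEN less_imp_neq, simplified])
  also have "\<dots> \<le> measure lborel (cball c \<sigma>)"
    using E_sub F(1) E_compact
    by (intro measure_mono_fmeasurable)
      (auto intro: borel_compact[OF compact_UN] fmeasurable_compact)
  finally show ?thesis .
qed

text \<open>Chooses the free parameters of the packing argument: a fraction \<open>t\<close> of the
  squared radius goes to the directions in \<open>J\<close>, the rest to the others.\<close>

lemma measure_thin_slices:
  fixes X :: "'a::euclidean_space set" and c :: 'a
  assumes X: "compact X" "X \<subseteq> cball c \<sigma>" and "0 < \<sigma>" and "0 < d"
    and J: "J \<subseteq> Basis" "card J = DIM('b::euclidean_space)"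
    and thin: "\<And>x y. \<lbrakk>x \<in> X; y \<in> X; \<And>i. i \<in> Basis - J \<Longrightarrow> x \<bullet> i = y \<bullet> i\<rbrakk> \<Longrightarrow> dist x y \<le> d"
  shows "measure lborel X \<le> exp (real DIM('b) / 2 + 1)
    * (sqrt ((real DIM('a) + 1) / real DIM('b)) * d / \<sigma>) ^ DIM('b) * measure lborel (cball c \<sigma>)"
proof -
  define k where "k = DIM('b)"
  define N where "N = DIM('a)"
  have k: "0 < k" by (simp add: k_def)
  have kN: "k \<le> N" unfolding k_def N_def using J by (metis card_mono finite_Basis)
  \<comment> \<open>Essentially the maximiser of \<open>t\<^sup>k (1 - t)\<^sup>N\<^sup>-\<^sup>k\<close>, kept below 1 so that \<open>q > 0\<close> when \<open>k = N\<close>.\<close>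
  define t where "t = real k / (real N + 1)"
  have t: "0 < t" "t < 1" using k kN by (auto simp: t_def)
  \<comment> \<open>Shrunken copy and translation share the radius \<open>sqrt t * \<sigma>\<close>
    in the ratio 1 to \<open>k\<close>; the loss is the factor \<open>(1 + 1 / k) ^ k\<close>, at
    most \<open>exp 1\<close>.\<close>
  define a where "a = sqrt t / (real k + 1)"
  define s where "s = sqrt t * \<sigma> * (real k / (real k + 1))"
  define q where "q = sqrt (1 - t)"
  have pos: "0 < a" "0 < s" "0 < q" using t k assms(3) by (auto simp: a_def s_def q_def)
  have "s + a * \<sigma> = (sqrt t * \<sigma>) * (real k / (real k + 1) + 1 / (real k + 1))"
    by (simp add: s_def a_def distrib_left)
  also have "real k / (real k + 1) + 1 / (real k + 1) = 1"
    by (simp flip: add_divide_distrib)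
  finally have "s + a * \<sigma> = sqrt t * \<sigma>" by simp
  then have "(s + a * \<sigma>)\<^sup>2 + (q * \<sigma>)\<^sup>2 = t * \<sigma>\<^sup>2 + (1 - t) * \<sigma>\<^sup>2"
    using t by (simp add: q_def power_mult_distrib)
  then have "(s + a * \<sigma>)\<^sup>2 + (q * \<sigma>)\<^sup>2 \<le> \<sigma>\<^sup>2" by (simp add: left_diff_distrib)
  then have main: "measure lborel X * (q ^ (N - k) * (s / d) ^ k) \<le> measure lborel (cball c \<sigma>)"
    unfolding k_def N_def
    by (intro measure_thin_slices_aux[OF X assms(3,4) J thin, where a = a])
      (use pos in \<open>simp_all add: less_imp_le\<close>)
  \<comment> \<open>For \<open>k < N\<close>, \<open>1 / (1 - t)\<close> is at most
    \<open>exp (k / (N - k))\<close>; the square root in \<open>q\<close> and the power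
    \<open>N - k\<close> turn this into \<open>exp (k / 2)\<close>.\<close>
  have q_bound: "1 / q ^ (N - k) \<le> exp (real k / 2)"
  proof (cases "N = k")
    case False
    then have Nk: "0 < N - k" "real (N - k) = real N - real k" using kN by auto
    have "1 / (1 - t) = 1 + real k / (real N + 1 - real k)"
      using kN by (simp add: t_def field_simps)
    also have "\<dots> \<le> 1 + real k / real (N - k)"
      using Nk by (intro add_left_mono divide_left_mono) auto
    also have "\<dots> \<le> exp (real k / real (N - k))" by (rule exp_ge_add_one_self)
    finally have "sqrt (1 / (1 - t)) \<le> sqrt (exp (real k / real (N - k)))" by (rule real_sqrt_le_mono)
    also have "\<dots> = exp (real k / real (N - k) / 2)"
      by (intro real_sqrt_unique) (simp_all flip: exp_double)
    finally have "1 / q \<le> exp (real k / real (N - k) / 2)" by (simp add: q_def real_sqrt_divide)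
    then have "(1 / q) ^ (N - k) \<le> exp (real k / real (N - k) / 2) ^ (N - k)"
      using pos by (intro power_mono) auto
    also have "\<dots> = exp (real (N - k) * (real k / real (N - k) / 2))"
      by (simp only: exp_of_nat_mult)
    also have "real (N - k) * (real k / real (N - k) / 2) = real k / 2"
      using Nk(1) by (simp del: of_nat_diff)
    finally show ?thesis by (simp add: power_one_over)
  qed simp
  have s_bound: "(d / s) ^ k \<le> exp 1 * (sqrt ((real N + 1) / real k) * d / \<sigma>) ^ k"
  proof -
    have "1 / sqrt t = sqrt ((real N + 1) / real k)"
      by (simp add: t_def real_sqrt_divide)
    moreover have "d / s = (1 + 1 / real k) * (1 / sqrt t * d / \<sigma>)"
      using k assms(3) t by (simp add: s_def field_simps)
    moreover have "(1 + 1 / real k) ^ k \<le> exp (1 / real k) ^ k"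
      by (intro power_mono) (auto simp: exp_ge_add_one_self)
    moreover have "exp (1 / real k) ^ k = exp (1::real)" using k by (simp flip: exp_of_nat_mult)
    ultimately show ?thesis using assms(3,4)
      by (simp only: power_mult_distrib mult.assoc times_divide_eq_right[symmetric])
        (auto intro!: mult_right_mono)
  qed
  have "measure lborel X = measure lborel X * (q ^ (N - k) * (s / d) ^ k) * ((1 / q ^ (N - k)) * (d / s) ^ k)"
    using pos assms(4) by (simp add: power_divide)
  also have "\<dots> \<le> measure lborel (cball c \<sigma>) * ((1 / q ^ (N - k)) * (d / s) ^ k)"
    using main pos assms(4) by (intro mult_right_mono) auto
  also have "\<dots> \<le> measure lborel (cball c \<sigma>)
      * (exp (real k / 2) * (exp 1 * (sqrt ((real N + 1) / real k) * d / \<sigma>) ^ k))"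
    using q_bound s_bound pos assms(4) by (intro mult_left_mono mult_mono) auto
  finally show ?thesis by (simp add: k_def N_def exp_add mult_ac)
qed

section \<open>Frames of spurious pairs\<close>

lemma inner_transpose: "transpose X \<bullet> transpose Y = X \<bullet> (Y :: real^'a^'b)"
  unfolding inner_vec_def by (subst sum.swap) (simp add: transpose_def)

lemma norm_transpose: "norm (transpose X) = norm (X :: real^'a^'b)"
  by (simp add: norm_eq_sqrt_inner inner_transpose)

lemma norm_matrix_vector_le: "norm (M *v v) \<le> norm M * norm v" for M :: "real^'a^'b"
proof -
  have "norm (M *v v) = L2_set (\<lambda>i. norm ((M *v v) $ i)) UNIV" by (simp add: norm_vec_def)
  also have "\<dots> \<le> L2_set (\<lambda>i. norm (M $ i) * norm v) UNIV"
    by (intro L2_set_mono) (auto simp: matrix_vector_mul_component Cauchy_Schwarz_ineq2)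
  also have "\<dots> = norm M * norm v" by (simp add: norm_vec_def L2_set_left_distrib)
  finally show ?thesis .
qed

text \<open>Rowwise estimate that charges \<open>M\<close> only its operator norm, so that no
  further dimensional factor enters when the frame is estimated.\<close>

lemma norm_matrix_mult_le_row_bound:
  fixes X :: "real^'b^'a" and M :: "real^'c^'b"
  assumes "\<And>v. norm (v v* M) \<le> c * norm v" and "0 \<le> c"
  shows "norm (X ** M) \<le> norm X * c"
proof -
  have row: "(X ** M) $ i = X $ i v* M" for i
    by (simp add: vec_eq_iff matrix_matrix_mult_def vector_matrix_mult_def mult.commute)
  have "norm (X ** M) = L2_set (\<lambda>i. norm (X $ i v* M)) UNIV" by (simp add: norm_vec_def row)
  also have "\<dots> \<le> L2_set (\<lambda>i. norm (X $ i) * c) UNIV"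
    using assms(1) by (intro L2_set_mono) (auto simp: mult.commute)
  also have "\<dots> = norm X * c" using assms(2) by (simp add: norm_vec_def L2_set_left_distrib)
  finally show ?thesis .
qed

lemma norm_matrix_mult_le: "norm (X ** M) \<le> norm X * norm M"
  for X :: "real^'b^'a" and M :: "real^'c^'b"
proof (rule norm_matrix_mult_le_row_bound)
  show "norm (v v* M) \<le> norm M * norm v" for v
    using norm_matrix_vector_le[of "transpose M" v] by (simp add: norm_transpose transpose_matrix_vector)
qed simp

text \<open>A matrix and its transpose have the same operator norm: pair \<open>v v* M\<close> with
  itself and move \<open>M\<close> to the other side.\<close>

lemma norm_vector_matrix_le:
  fixes M :: "real^'a^'b"
  assumes "\<And>w. norm (M *v w) \<le> c * norm w"
  shows "norm (v v* M) \<le> c * norm v"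
proof (cases "v v* M = 0")
  case True
  have "0 \<le> c * norm w" for w :: "real^'a" using assms[of w] norm_ge_zero order_trans by blast
  from this[of "axis undefined 1"] have "0 \<le> c" by (simp add: norm_axis_1)
  then show ?thesis using True by simp
next
  case False
  have "norm (v v* M) * norm (v v* M) = (v v* M) \<bullet> (v v* M)" by (simp add: norm_eq_sqrt_inner)
  also have "\<dots> = v \<bullet> (M *v (v v* M))"
    by (simp add: dot_lmul_matrix)
  also have "\<dots> \<le> norm v * (c * norm (v v* M))"
    by (rule order_trans[OF norm_cauchy_schwarz mult_left_mono[OF assms norm_ge_zero]])
  finally show ?thesis using False by (simp add: mult_ac)
qed

lemma norm_le_of_entries_le_1:
  fixes Z :: "real^'p^'n"
  assumes "\<And>k j. \<bar>Z $ k $ j\<bar> \<le> 1"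
  shows "norm Z \<le> sqrt (real CARD('n) * real CARD('p))"
proof -
  have "Z \<bullet> Z \<le> (\<Sum>k\<in>(UNIV :: 'n set). \<Sum>j\<in>(UNIV :: 'p set). 1)"
    unfolding inner_vec_def
    by (intro sum_mono) (use assms in \<open>simp add: abs_square_le_1 flip: power2_eq_square\<close>)
  then show ?thesis by (simp add: norm_eq_sqrt_inner)
qed

text \<open>The rank-one matrix \<open>x z^T\<close>.\<close>

definition outer :: "real^'n \<Rightarrow> real^'p \<Rightarrow> real^'p^'n"
  where "outer x z = (\<chi> i j. x $ i * z $ j)"

lemma norm_outer: "norm (outer x z) = norm x * norm z"
proof -
  have row: "outer x z $ i = x $ i *\<^sub>R z" for i
    by (simp add: outer_def vec_eq_iff)
  have "norm (outer x z) = L2_set (\<lambda>i. norm (x $ i) * norm z) UNIV"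
    by (simp only: norm_vec_def[of "outer x z"] row norm_scaleR real_norm_def)
  also have "\<dots> = norm x * norm z" by (simp only: L2_set_left_distrib norm_ge_zero norm_vec_def[of x])
  finally show ?thesis .
qed

lemma outer_mult_transpose: "outer x z ** transpose Y = outer x (Y *v z)"
  by (simp add: outer_def matrix_matrix_mult_def transpose_def vec_eq_iff matrix_vector_mult_def
      sum_distrib_left mult_ac)

lemma outer_scaleR: "outer x (r *\<^sub>R z) = r *\<^sub>R outer x z"
  by (simp add: outer_def vec_eq_iff)

lemma outer_self_mult_transpose: "outer x z ** transpose (outer x z) = (z \<bullet> z) *\<^sub>R outer x x"
proof -
  have "outer x z *v z = (z \<bullet> z) *\<^sub>R x"
    by (simp add: outer_def vec_eq_iff matrix_vector_mult_def inner_vec_def sum_distrib_left mult_ac)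
  then show ?thesis by (simp add: outer_mult_transpose outer_scaleR)
qed

lemma inner_outer: "S \<bullet> outer x y = x \<bullet> (S *v y)"
  by (simp add: outer_def inner_vec_def matrix_vector_mult_def sum_distrib_left mult_ac)

lemma transpose_mat_of: "transpose (mat_of X) = mat_of X"
  using mat_of[of X] by simp

section \<open>Norm bounds for \<open>calA\<close> and its adjoint\<close>

lemma bounded_linear_calA_sym: "bounded_linear (\<lambda>X. calA A (mat_of X))"
  unfolding linear_conv_bounded_linear[symmetric] calA_def
  by (rule linearI)
    (simp_all add: vec_eq_iff plus_sym_mat.rep_eq scaleR_sym_mat.rep_eq inner_add_right)

lemma norm_calA_nonneg: "0 \<le> norm_calA A"
  unfolding norm_calA_def by (rule onorm_pos_le[OF bounded_linear_calA_sym])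

text \<open>Only the symmetric part of \<open>M\<close> is seen by \<open>calA A\<close>, and it is no longer than \<open>M\<close>.\<close>

lemma norm_calA_le: "norm (calA A M) \<le> norm_calA A * norm M"
proof -
  define X where "X = Sym ((1 / 2) *\<^sub>R (M + transpose M))"
  have X: "mat_of X = (1 / 2) *\<^sub>R (M + transpose M)"
    unfolding X_def by (rule Sym_inverse) (simp add: transpose_def vec_eq_iff add.commute)
  have tr: "mat_of (A i) \<bullet> transpose M = mat_of (A i) \<bullet> M" for i
    using inner_transpose[of "mat_of (A i)" M] by (simp add: transpose_mat_of)
  have "calA A M = calA A (mat_of X)"
    by (simp add: calA_def vec_eq_iff X inner_add_right tr)
  also have "norm \<dots> \<le> norm_calA A * norm X"
    unfolding norm_calA_def by (rule onorm[OF bounded_linear_calA_sym])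
  also have "\<dots> \<le> norm_calA A * norm M"
    using norm_triangle_ineq[of M "transpose M"] norm_calA_nonneg[of A]
    by (intro mult_left_mono) (simp_all add: norm_sym_mat_def X norm_transpose)
  finally show ?thesis .
qed

lemma linear_calA_adj: "linear (calA_adj A)"
  by (rule linearI) (simp_all add: calA_adj_def scaleR_left_distrib sum.distrib scaleR_sum_right)

text \<open>By adjointness the squared norm of \<open>calA_adj A l\<close> is the inner product of
  \<open>l\<close> with \<open>calA A\<close> at that same matrix; apply Cauchy-Schwarz and cancel
  one norm.\<close>

lemma norm_calA_adj_le: "norm (calA_adj A l) \<le> norm_calA A * norm l"
proof (cases "calA_adj A l = 0")
  case False
  let ?S = "calA_adj A l"
  have "norm ?S * norm ?S = ?S \<bullet> ?S" by (simp add: norm_eq_sqrt_inner)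
  also have "\<dots> = (\<Sum>i\<in>UNIV. l $ i * (A i \<bullet> ?S))"
    by (subst (1) calA_adj_def) (simp add: inner_sum_left)
  also have "\<dots> = l \<bullet> calA A (mat_of ?S)"
    by (simp add: calA_def inner_vec_def inner_sym_mat_def)
  also have "\<dots> \<le> norm l * (norm_calA A * norm ?S)"
    using norm_calA_le[of A "mat_of ?S"]
    by (intro order_trans[OF norm_cauchy_schwarz] mult_left_mono) (auto simp: norm_sym_mat_def)
  finally show ?thesis using False by (simp add: mult_ac)
qed (simp add: norm_calA_nonneg)

lemma transpose_slack: "transpose (slack A C lam) = slack A C lam"
  by (simp add: slack_def transpose_mat_of)

lemma psd_gram: "psd (Y ** transpose Y)"
proof -
  have "v \<bullet> ((Y ** transpose Y) *v v) = (v v* Y) \<bullet> (v v* Y)" for v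
    by (simp add: dot_lmul_matrix transpose_matrix_vector flip: matrix_vector_mul_assoc)
  then show ?thesis by (simp add: psd_def matrix_transpose_mul)
qed

text \<open>The other clauses of approximate optimality are automatic for an AFAC pair: feasibility
  is shared, \<open>Y Y^T\<close> is a Gram matrix, and multiplying \<open>S Y\<close> by
  \<open>Y^T\<close> costs at most \<open>R_Y\<close>. Thus a spurious pair is one whose shifted
  slack is not positive semidefinite.\<close>

lemma approx_optimal_iff_psd:
  assumes "AFAC A b C \<epsilon>0 \<epsilon>1 \<epsilon>2 \<gamma> Y lam" and "norm Y \<le> R_Y" and "0 \<le> \<epsilon>1"
  shows "approx_optimal A b C \<epsilon>0 (R_Y * \<epsilon>1) \<epsilon>2 (Y ** transpose Y) lam
    \<longleftrightarrow> psd (slack A C lam + \<epsilon>2 *\<^sub>R mat 1)"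
proof -
  let ?S = "slack A C lam"
  have "norm (?S ** Y ** transpose Y) \<le> norm (?S ** Y) * norm Y"
    using norm_matrix_mult_le[of "?S ** Y" "transpose Y"] by (simp add: norm_transpose)
  also have "\<dots> \<le> \<epsilon>1 * R_Y"
    using assms by (intro mult_mono) (auto simp: AFAC_def)
  finally have "norm (?S ** (Y ** transpose Y)) \<le> R_Y * \<epsilon>1"
    by (simp add: matrix_mul_assoc mult.commute)
  then show ?thesis
    using assms(1) psd_gram[of Y] by (auto simp: AFAC_def approx_optimal_def)
qed

lemma psd_slack_iff:
  "psd (slack A C lam + e *\<^sub>R mat 1)
    \<longleftrightarrow> (\<forall>v. 0 \<le> v \<bullet> (slack A C lam *v v) + e * (v \<bullet> v))"
proof -
  have "transpose (slack A C lam + e *\<^sub>R mat 1) = slack A C lam + e *\<^sub>R mat 1"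
    using transpose_slack[of A C lam] by (simp add: vec_eq_iff transpose_def mat_def)
  then show ?thesis
    by (simp add: psd_def matrix_vector_mult_add_rdistrib inner_add_right
        flip: scaleR_matrix_vector_assoc)
qed

text \<open>Otherwise, with \<open>z\<close> normalised to \<open>z'\<close>, each direction
  \<open>x z'^T\<close> with unit \<open>x\<close> satisfies the constraint, because
  \<open>x z'^T Y^T = x (Y z')^T\<close>. Its curvature is \<open>x \<bullet> (S *v x)\<close>, so
  the second-order condition would make the shifted slack positive semidefinite.\<close>

lemma spurious_AFAC_full_rank:
  fixes Y :: "real^'p^'n"
  assumes sp: "spurious_AFAC A b C R_Y R_lam \<epsilon>0 \<epsilon>1 \<epsilon>2 \<gamma> Y lam"
    and "0 \<le> \<epsilon>1" and "z \<noteq> 0"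
  shows "\<gamma> * norm z < norm_calA A * norm (Y *v z)"
proof (rule ccontr)
  assume "\<not> ?thesis"
  then have small: "norm_calA A * norm (Y *v z) \<le> \<gamma> * norm z" by simp
  let ?S = "slack A C lam"
  define z' where "z' = z /\<^sub>R norm z"
  have z': "norm z' = 1" using assms(3) by (simp add: z'_def)
  have "norm_calA A * norm (Y *v z') = norm_calA A * norm (Y *v z) / norm z"
    by (simp add: z'_def matrix_vector_mult_scaleR divide_inverse mult_ac)
  also have "\<dots> \<le> \<gamma>" using small assms(3) by (subst pos_divide_le_eq) auto
  finally have Yz': "norm_calA A * norm (Y *v z') \<le> \<gamma>" .
  have unit: "- \<epsilon>2 \<le> x \<bullet> (?S *v x)" if "norm x = 1" for x
  proof -
    have "norm (calA A (outer x z' ** transpose Y)) \<le> \<gamma>"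
      using norm_calA_le[of A "outer x (Y *v z')"] Yz' that
      by (simp add: outer_mult_transpose norm_outer)
    then have "- \<epsilon>2 \<le> ?S \<bullet> (outer x z' ** transpose (outer x z'))"
      using sp that z' by (auto simp: spurious_AFAC_def AFAC_def norm_outer)
    then show ?thesis
      using z' by (simp add: outer_self_mult_transpose inner_outer dot_square_norm)
  qed
  \<comment> \<open>Both terms are quadratic in \<open>v\<close>, so the bound on unit vectors
    extends by homogeneity.\<close>
  have "0 \<le> v \<bullet> (?S *v v) + \<epsilon>2 * (v \<bullet> v)" for v
  proof (cases "v = 0")
    case False
    define x where "x = v /\<^sub>R norm v"
    have "v = norm v *\<^sub>R x" "norm x = 1" using False by (auto simp: x_def)
    have "?S *v v = norm v *\<^sub>R (?S *v x)"
      by (subst \<open>v = norm v *\<^sub>R x\<close>) (rule matrix_vector_mult_scaleR)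
    then have "v \<bullet> (?S *v v) = (norm v)\<^sup>2 * (x \<bullet> (?S *v x))"
      by (subst (1) \<open>v = norm v *\<^sub>R x\<close>) (simp add: power2_eq_square del: norm_scaleR)
    then have "v \<bullet> (?S *v v) + \<epsilon>2 * (v \<bullet> v) = (norm v)\<^sup>2 * (x \<bullet> (?S *v x) + \<epsilon>2)"
      by (simp add: dot_square_norm algebra_simps)
    also have "\<dots> \<ge> 0" using unit[OF \<open>norm x = 1\<close>] by simp
    finally show ?thesis .
  qed simp
  then have "psd (?S + \<epsilon>2 *\<^sub>R mat 1)" by (simp add: psd_slack_iff)
  then show False
    using sp assms(2) approx_optimal_iff_psd[of A b C \<epsilon>0 \<epsilon>1 \<epsilon>2 \<gamma> Y lam R_Y]
    by (auto simp: spurious_AFAC_def)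
qed

text \<open>A vector orthogonal to all rows would lie in the kernel, so the rows span; a basis
  chosen among them, indexed by \<open>'p\<close>, gives an invertible square block.\<close>

lemma ex_nonzero_minor:
  fixes Y :: "real^'p^'n"
  assumes inj: "\<And>z. z \<noteq> 0 \<Longrightarrow> Y *v z \<noteq> 0"
  shows "\<exists>f :: 'p \<Rightarrow> 'n. det (\<chi> i. Y $ f i) \<noteq> 0"
proof -
  have "span (range (($) Y)) = UNIV"
  proof (rule ccontr)
    assume "span (range (($) Y)) \<noteq> UNIV"
    then obtain z where z: "z \<noteq> 0" "\<And>x. x \<in> span (range (($) Y)) \<Longrightarrow> z \<bullet> x = 0"
      using span_not_UNIV_orthogonal by blast
    have "Y $ k \<bullet> z = 0" for k
      using z(2)[OF span_base[of "Y $ k"]] by (simp add: inner_commute)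
    then have "Y *v z = 0" by (simp add: vec_eq_iff matrix_vector_mul_component)
    then show False using inj z(1) by blast
  qed
  then have "dim (range (($) Y)) = CARD('p)"
    using dim_span[of "range (($) Y)"] by simp
  then obtain B where B: "B \<subseteq> range (($) Y)" "independent B" "card B = CARD('p)"
    using basis_exists[of "range (($) Y)"] by metis
  have finB: "finite B" using B(1) finite_subset by fastforce
  obtain g where g: "bij_betw g (UNIV :: 'p set) B"
    using finite_same_card_bij[OF finite finB] B(3) by metis
  then have "\<forall>i. \<exists>k. g i = Y $ k" using B(1) by (auto simp: bij_betw_def)
  then obtain f where f: "\<And>i. g i = Y $ f i" by metis
  \<comment> \<open>Independence is known for the set \<open>B\<close>; the bijection
    \<open>g\<close> turns it into independence of the indexed family of rows.\<close>
  have "\<forall>i. c i = 0" if "(\<Sum>i\<in>UNIV. c i *s row i (\<chi> i. Y $ f i)) = 0" for c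
  proof -
    have "(\<Sum>i\<in>UNIV. c i *\<^sub>R g i) = 0"
      using that by (simp add: row_def f scalar_mult_eq_scaleR)
    moreover have "(\<Sum>x\<in>B. c (inv g x) *\<^sub>R x) = (\<Sum>i\<in>UNIV. c i *\<^sub>R g i)"
      using g by (intro sum.reindex_bij_betw[OF g, symmetric, THEN trans] sum.cong)
        (auto simp: bij_betw_def)
    ultimately have "c (inv g x) = 0" if "x \<in> B" for x
      using B(2) finB that by (auto simp: independent_explicit)
    moreover have "inv g (g i) = i" "g i \<in> B" for i using g by (auto simp: bij_betw_def)
    ultimately show ?thesis by metis
  qed
  then have "invertible (\<chi> i. Y $ f i)"
    by (simp add: invertible_right_inverse matrix_right_invertible_independent_rows)
  then show ?thesis by (auto simp: invertible_det_nz)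
qed

text \<open>Normalise \<open>Y\<close> by its largest maximal minor; Cramer's rule then bounds the entries by 1.\<close>

lemma ex_bounded_frame:
  fixes Y :: "real^'p^'n"
  assumes inj: "\<And>z. z \<noteq> 0 \<Longrightarrow> Y *v z \<noteq> 0"
  obtains f :: "'p \<Rightarrow> 'n" and G :: "real^'p^'p"
  where "inj f" "\<And>i j. (Y ** G) $ f i $ j = (if i = j then 1 else 0)"
    "\<And>k j. \<bar>(Y ** G) $ k $ j\<bar> \<le> 1"
proof -
  define D where "D f = (\<chi> i. Y $ f i)" for f :: "'p \<Rightarrow> 'n"
  have "finite (range (\<lambda>f. \<bar>det (D f)\<bar>))" by simp
  then obtain f where f: "\<And>g. \<bar>det (D g)\<bar> \<le> \<bar>det (D f)\<bar>"
    using Max_in[of "range (\<lambda>f. \<bar>det (D f)\<bar>)"] Max_ge[of "range (\<lambda>f. \<bar>det (D f)\<bar>)"]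
    by (metis (no_types, lifting) UNIV_I empty_iff imageE image_eqI)
  have nz: "det (D f) \<noteq> 0"
    using ex_nonzero_minor[OF inj] f by (metis D_def abs_le_zero_iff abs_zero)
  then obtain G where G: "D f ** G = mat 1" "G ** D f = mat 1"
    using invertible_det_nz unfolding invertible_def by blast
  have Z: "(Y ** G) $ f i $ j = (if i = j then 1 else 0)" for i j
  proof -
    have "(Y ** G) $ f i $ j = (D f ** G) $ i $ j" by (simp add: matrix_matrix_mult_def D_def)
    then show ?thesis by (simp add: G mat_def)
  qed
  have bound: "\<bar>(Y ** G) $ k $ j\<bar> \<le> 1" for k j
  proof -
    let ?Z = "Y ** G"
    have "Y $ k = (?Z ** D f) $ k" by (simp add: G flip: matrix_mul_assoc)
    also have "\<dots> = (\<Sum>i\<in>UNIV. ?Z $ k $ i *s row i (D f))"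
      by (simp add: vec_eq_iff matrix_matrix_mult_def[of ?Z] row_def)
    finally have Yk: "(\<Sum>i\<in>UNIV. ?Z $ k $ i *s row i (D f)) = Y $ k" ..
    \<comment> \<open>Replacing the \<open>j\<close>-th chosen row by row \<open>k\<close> of
      \<open>Y\<close> is again a choice of rows, so the new determinant is no larger in absolute
      value; Cramer's rule identifies it as the entry of \<open>Y ** G\<close> times the old
      one.\<close>
    have "(\<chi> i. if i = j then Y $ k else row i (D f)) = D (f(j := k))"
      by (auto simp: D_def row_def vec_eq_iff)
    then have "det (D (f(j := k))) = ?Z $ k $ j * det (D f)"
      using cramer_lemma_transpose[of j "?Z $ k" "D f"] unfolding Yk by simp
    then have "\<bar>?Z $ k $ j\<bar> * \<bar>det (D f)\<bar> \<le> 1 * \<bar>det (D f)\<bar>"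
      using f[of "f(j := k)"] by (simp add: abs_mult)
    then show ?thesis by (rule mult_right_le_imp_le) (use nz in simp)
  qed
  have "inj f"
  proof (rule injI)
    fix i j assume "f i = f j"
    then show "i = j" using Z[of i i] Z[of j i] by (metis zero_neq_one)
  qed
  then show thesis using Z bound that by blast
qed

text \<open>Take \<open>Z = Y ** G\<close> with \<open>G\<close> the inverse of the dominant block.
  The full-rank inequality at \<open>G *v w\<close> bounds the operator norm of \<open>G\<close> by
  that of \<open>Z\<close> times \<open>norm_calA A / \<gamma>\<close>, and
  \<open>S Z = (S Y) G\<close> inherits smallness from \<open>S Y\<close>.\<close>

lemma spurious_AFAC_frame:
  fixes Y :: "real^'p^'n"
  assumes sp: "spurious_AFAC A b C R_Y R_lam \<epsilon>0 \<epsilon>1 \<epsilon>2 \<gamma> Y lam"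
    and "0 \<le> \<epsilon>1" and "0 < \<gamma>"
  obtains f :: "'p \<Rightarrow> 'n" and Z :: "real^'p^'n"
  where "inj f" "\<And>i j. Z $ f i $ j = (if i = j then 1 else 0)"
    "norm Z \<le> sqrt (real CARD('n) * real CARD('p))"
    "norm (slack A C lam ** Z) \<le> sqrt (real CARD('n) * real CARD('p)) * (\<epsilon>1 * norm_calA A / \<gamma>)"
proof -
  have rank: "\<gamma> * norm z < norm_calA A * norm (Y *v z)" if "z \<noteq> 0" for z
    using spurious_AFAC_full_rank[OF sp assms(2) that] .
  have "Y *v z \<noteq> 0" if "z \<noteq> 0" for z
  proof
    assume "Y *v z = 0"
    then have "\<gamma> * norm z < 0" using rank[OF that] by simp
    moreover have "0 \<le> \<gamma> * norm z" using assms(3) by simp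
    ultimately show False by simp
  qed
  then obtain f :: "'p \<Rightarrow> 'n" and G
    where fG: "inj f" "\<And>i j. (Y ** G) $ f i $ j = (if i = j then 1 else 0)"
      "\<And>k j. \<bar>(Y ** G) $ k $ j\<bar> \<le> 1"
    using ex_bounded_frame by metis
  define N where "N = sqrt (real CARD('n) * real CARD('p))"
  have N: "norm (Y ** G) \<le> N" unfolding N_def using fG(3) by (rule norm_le_of_entries_le_1)
  have G: "norm (G *v w) \<le> (N * norm_calA A / \<gamma>) * norm w" for w
  proof -
    have "\<gamma> * norm (G *v w) \<le> norm_calA A * norm (Y *v (G *v w))"
      using rank[of "G *v w"] by (cases "G *v w = 0") auto
    also have "\<dots> \<le> norm_calA A * (N * norm w)"
      using order_trans[OF norm_matrix_vector_le mult_right_mono[OF N]] norm_calA_nonneg[of A]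
      by (intro mult_left_mono) (auto simp: matrix_vector_mul_assoc)
    finally show ?thesis using assms(3) by (simp add: field_simps)
  qed
  have "norm (slack A C lam ** Y ** G) \<le> norm (slack A C lam ** Y) * (N * norm_calA A / \<gamma>)"
    using norm_calA_nonneg[of A] assms(3)
    by (intro norm_matrix_mult_le_row_bound norm_vector_matrix_le G) (auto simp: N_def)
  also have "\<dots> \<le> \<epsilon>1 * (N * norm_calA A / \<gamma>)"
    using sp norm_calA_nonneg[of A] assms(3)
    by (intro mult_right_mono) (auto simp: spurious_AFAC_def AFAC_def N_def)
  finally have "norm (slack A C lam ** (Y ** G)) \<le> N * (\<epsilon>1 * norm_calA A / \<gamma>)"
    by (simp add: matrix_mul_assoc mult_ac)
  then show thesis using fG(1,2) N that unfolding N_def by blast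
qed

section \<open>Tubes of cost matrices\<close>

lemma sym_unit_eq_iff: "sym_unit i j = sym_unit k l \<longleftrightarrow> {i, j} = {k, l}"
proof
  assume eq: "sym_unit i j = sym_unit k l"
  have "mat_of (sym_unit i j) $ i $ j \<noteq> 0" by (simp add: sym_unit.rep_eq)
  then have "mat_of (sym_unit k l) $ i $ j \<noteq> 0" by (simp add: eq)
  then show "{i, j} = {k, l}" by (auto simp: sym_unit.rep_eq split: if_splits)
qed (auto simp: doubleton_eq_iff sym_unit_commute)

lemma card_image_eq_of_same_fibres:
  assumes "\<And>x y. x \<in> S \<Longrightarrow> y \<in> S \<Longrightarrow> u x = u y \<longleftrightarrow> v x = v y"
  shows "card (u ` S) = card (v ` S)"
proof (rule bij_betw_same_card)
  let ?h = "\<lambda>a. v (inv_into S u a)"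
  have inv: "v (inv_into S u (u x)) = v x" if "x \<in> S" for x
    using assms[of "inv_into S u (u x)" x] that by (auto simp: inv_into_into f_inv_into_f)
  show "bij_betw ?h (u ` S) (v ` S)"
    unfolding bij_betw_def
  proof
    show "inj_on ?h (u ` S)" using assms inv by (auto simp: inj_on_def)
    show "?h ` u ` S = v ` S" using inv by (auto simp: image_iff)
  qed
qed

text \<open>Basis matrices correspond to unordered index pairs, repetition allowed: singletons and
  doubletons together, counted by Pascal's rule.\<close>

lemma card_sym_units:
  assumes "finite I"
  shows "card {sym_unit i j | i j. i \<in> I \<and> j \<in> I} = tau (card I)"
proof -
  have "{sym_unit i j | i j. i \<in> I \<and> j \<in> I} = (\<lambda>(i, j). sym_unit i j) ` (I \<times> I)" by auto
  also have "card \<dots> = card ((\<lambda>(i, j). {i, j}) ` (I \<times> I))"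
    by (rule card_image_eq_of_same_fibres) (auto simp: sym_unit_eq_iff)
  also have "(\<lambda>(i, j). {i, j}) ` (I \<times> I) = {B. B \<subseteq> I \<and> card B = 1} \<union> {B. B \<subseteq> I \<and> card B = 2}"
  proof (intro equalityI subsetI)
    fix B assume "B \<in> (\<lambda>(i, j). {i, j}) ` (I \<times> I)"
    then obtain i j where "B = {i, j}" "i \<in> I" "j \<in> I" by auto
    then show "B \<in> {B. B \<subseteq> I \<and> card B = 1} \<union> {B. B \<subseteq> I \<and> card B = 2}"
      by (cases "i = j") auto
  next
    fix B assume "B \<in> {B. B \<subseteq> I \<and> card B = 1} \<union> {B. B \<subseteq> I \<and> card B = 2}"
    then obtain i j where "B = {i, j}" "i \<in> I" "j \<in> I"
      by (auto simp: card_1_singleton_iff card_2_iff)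
    then show "B \<in> (\<lambda>(i, j). {i, j}) ` (I \<times> I)" by auto
  qed
  also have "card \<dots> = (card I choose 1) + (card I choose 2)"
    using assms by (subst card_Un_disjoint) (auto simp: n_subsets)
  finally show ?thesis by (simp add: tau_def numeral_2_eq_2)
qed

lemma DIM_sym_mat: "DIM('n::finite sym_mat) = tau CARD('n)"
  using card_sym_units[of "UNIV :: 'n set"] by (simp add: Basis_sym_mat_def)

lemma tau_real: "real (tau k) = real k * (real k + 1) / 2"
  by (simp add: tau_def choose_two real_of_nat_div algebra_simps)

lemma sum_eq_sum_range:
  fixes h :: "'n::finite \<Rightarrow> 'b::comm_monoid_add" and f :: "'p::finite \<Rightarrow> 'n"
  assumes "inj f" and "\<And>k. k \<notin> range f \<Longrightarrow> h k = 0"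
  shows "(\<Sum>k\<in>UNIV. h k) = (\<Sum>i\<in>UNIV. h (f i))"
proof -
  have "(\<Sum>k\<in>UNIV. h k) = (\<Sum>k\<in>range f. h k)"
    using assms(2) by (intro sum.mono_neutral_right) auto
  then show ?thesis using assms(1) by (simp add: sum.reindex)
qed

section \<open>Matrices that differ only on one block\<close>

lemma matrix_mult_diff_left: "(X - Y) ** M = X ** M - Y ** (M :: real^'c^'b)"
  by (simp add: vec_eq_iff matrix_matrix_mult_def left_diff_distrib sum_subtractf)

lemma matrix_mult_diff_right: "M ** (X - Y) = M ** X - M ** (Y :: real^'c^'b)"
  by (simp add: vec_eq_iff matrix_matrix_mult_def right_diff_distrib sum_subtractf)

text \<open>On the block indexed by \<open>range f\<close> both frames are the identity, so a difference \<open>\<Delta> = x - y\<close>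
  supported there equals \<open>W\<^sup>T \<Delta> Z = W\<^sup>T (x Z) - (y W)\<^sup>T Z\<close>.\<close>

lemma dist_le_of_common_block:
  fixes x y L :: "'n::finite sym_mat" and f :: "'p::finite \<Rightarrow> 'n" and Z W :: "real^'p^'n"
  assumes "inj f"
    and Z: "\<And>i j. Z $ f i $ j = (if i = j then 1 else 0)" "norm Z \<le> N" "norm (mat_of (x - L) ** Z) \<le> \<rho>"
    and W: "\<And>i j. W $ f i $ j = (if i = j then 1 else 0)" "norm W \<le> N" "norm (mat_of (y - L) ** W) \<le> \<rho>"
    and agree: "\<And>u. u \<in> Basis - {sym_unit k l | k l. k \<in> range f \<and> l \<in> range f} \<Longrightarrow> x \<bullet> u = y \<bullet> u"
  shows "dist x y \<le> 2 * N * \<rho>"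
proof -
  define \<Delta> where "\<Delta> = mat_of (x - y)"
  have supp: "\<Delta> $ k $ l = 0" if "k \<notin> range f \<or> l \<notin> range f" for k l
  proof -
    have "sym_unit k l \<in> Basis - {sym_unit k l | k l. k \<in> range f \<and> l \<in> range f}"
      using that by (auto simp: Basis_sym_mat_def sym_unit_eq_iff doubleton_eq_iff)
    then have "(x - y) \<bullet> sym_unit k l = 0" using agree by (simp add: inner_diff_left)
    then show ?thesis by (auto simp: inner_sym_unit \<Delta>_def split: if_splits)
  qed
  have block: "(transpose W ** \<Delta> ** Z) $ i $ j = \<Delta> $ f i $ f j" for i j
  proof -
    have "(transpose W ** \<Delta>) $ i $ l = \<Delta> $ f i $ l" for l
    proof -
      have "(transpose W ** \<Delta>) $ i $ l = (\<Sum>k\<in>UNIV. W $ k $ i * \<Delta> $ k $ l)"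
        by (simp add: matrix_matrix_mult_def transpose_def)
      also have "\<dots> = (\<Sum>a\<in>UNIV. W $ f a $ i * \<Delta> $ f a $ l)"
        using assms(1) supp by (intro sum_eq_sum_range) auto
      finally show ?thesis by (simp add: W(1) if_distrib[of "\<lambda>c. c * _"] cong: if_cong)
    qed
    then have "(transpose W ** \<Delta> ** Z) $ i $ j = (\<Sum>l\<in>UNIV. \<Delta> $ f i $ l * Z $ l $ j)"
      by (simp add: matrix_matrix_mult_def[of "transpose W ** \<Delta>"])
    also have "\<dots> = (\<Sum>a\<in>UNIV. \<Delta> $ f i $ f a * Z $ f a $ j)"
      using assms(1) supp by (intro sum_eq_sum_range) auto
    finally show ?thesis by (simp add: Z(1) if_distrib[of "\<lambda>c. _ * c"] cong: if_cong)
  qed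
  have "\<Delta> \<bullet> \<Delta> = (\<Sum>k\<in>UNIV. \<Sum>l\<in>UNIV. \<Delta> $ k $ l * \<Delta> $ k $ l)" by (simp add: inner_vec_def)
  also have "\<dots> = (\<Sum>i\<in>UNIV. \<Sum>l\<in>UNIV. \<Delta> $ f i $ l * \<Delta> $ f i $ l)"
    using assms(1) supp by (intro sum_eq_sum_range) auto
  also have "\<dots> = (\<Sum>i\<in>UNIV. \<Sum>j\<in>UNIV. \<Delta> $ f i $ f j * \<Delta> $ f i $ f j)"
    using assms(1) supp by (intro sum.cong refl sum_eq_sum_range) auto
  also have "\<dots> = (transpose W ** \<Delta> ** Z) \<bullet> (transpose W ** \<Delta> ** Z)"
    by (simp add: inner_vec_def block)
  finally have "norm \<Delta> = norm (transpose W ** \<Delta> ** Z)" by (simp add: norm_eq_sqrt_inner)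
  \<comment> \<open>The common centre \<open>L\<close> cancels in \<open>\<Delta>\<close>, and
    symmetry of \<open>y - L\<close> lets it act on \<open>W\<close> instead of
    \<open>Z\<close>.\<close>
  also have "transpose W ** \<Delta> ** Z
      = transpose W ** (mat_of (x - L) ** Z) - transpose (mat_of (y - L) ** W) ** Z"
  proof -
    have \<Delta>: "\<Delta> = mat_of (x - L) - mat_of (y - L)"
      by (simp add: \<Delta>_def minus_sym_mat.rep_eq)
    show ?thesis
      by (simp add: \<Delta> matrix_transpose_mul transpose_mat_of matrix_mul_assoc
          matrix_mult_diff_left matrix_mult_diff_right)
  qed
  also have "norm \<dots> \<le> norm W * norm (mat_of (x - L) ** Z) + norm (mat_of (y - L) ** W) * norm Z"
    by (intro order_trans[OF norm_triangle_ineq4] add_mono)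
      (use norm_matrix_mult_le norm_transpose in metis)+
  also have "\<dots> \<le> N * \<rho> + \<rho> * N"
    using Z W by (intro add_mono mult_mono) (auto intro: order_trans[OF norm_ge_zero])
  finally show ?thesis by (simp add: dist_norm norm_sym_mat_def \<Delta>_def)
qed

section \<open>Continuity of the matrix operations\<close>

lemma linear_mat_of: "linear (mat_of :: 'n::finite sym_mat \<Rightarrow> real^'n^'n)"
  by (rule linearI) (simp_all add: plus_sym_mat.rep_eq scaleR_sym_mat.rep_eq)

lemma continuous_on_mat_of [continuous_intros]:
  "continuous_on S g \<Longrightarrow> continuous_on S (\<lambda>x. mat_of (g x))"
  using bounded_linear.continuous_on linear_conv_bounded_linear linear_mat_of by blast

lemma continuous_on_matrix_mult [continuous_intros]:
  fixes g :: "'a::topological_space \<Rightarrow> real^'b^'c" and h :: "'a \<Rightarrow> real^'d^'b"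
  assumes "continuous_on S g" and "continuous_on S h"
  shows "continuous_on S (\<lambda>x. g x ** h x)"
  unfolding matrix_matrix_mult_def by (intro continuous_intros assms)

lemma continuous_on_matrix_vector_mult [continuous_intros]:
  fixes g :: "'a::topological_space \<Rightarrow> real^'b^'c"
  assumes "continuous_on S g" and "continuous_on S h"
  shows "continuous_on S (\<lambda>x. g x *v h x)"
  unfolding matrix_vector_mult_def by (intro continuous_intros assms)

lemma continuous_on_transpose [continuous_intros]:
  fixes g :: "'a::topological_space \<Rightarrow> real^'b^'c"
  assumes "continuous_on S g"
  shows "continuous_on S (\<lambda>x. transpose (g x))"
  unfolding transpose_def by (intro continuous_intros assms)

lemma continuous_on_calA [continuous_intros]:
  "continuous_on S g \<Longrightarrow> continuous_on S (\<lambda>x. calA A (g x))"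
  unfolding calA_def by (intro continuous_intros)

lemma continuous_on_slack [continuous_intros]:
  assumes "continuous_on S g" and "continuous_on S h"
  shows "continuous_on S (\<lambda>x. slack A (g x) (h x))"
  unfolding slack_def calA_adj_def by (intro continuous_intros assms)

text \<open>\<open>Y\<close> and the multiplier are eliminated: \<open>L\<close> stands for
  \<open>calA_adj\<close> at a net point, and only the chosen rows \<open>f\<close> remain as
  discrete data. The bound on \<open>norm Z\<close> makes the tube the projection of a compact
  set.\<close>

definition frame_tube ::
  "('p::finite \<Rightarrow> 'n::finite) \<Rightarrow> 'n sym_mat \<Rightarrow> real \<Rightarrow> 'n sym_mat \<Rightarrow> real \<Rightarrow> real \<Rightarrow> 'n sym_mat set"
  where "frame_tube f c \<sigma> L N \<rho> = {C \<in> cball c \<sigma>. \<exists>Z :: real^'p^'n.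
    (\<forall>i j. Z $ f i $ j = (if i = j then 1 else 0)) \<and> norm Z \<le> N \<and> norm (mat_of (C - L) ** Z) \<le> \<rho>}"

lemma compact_frame_tube:
  fixes f :: "'p::finite \<Rightarrow> 'n::finite"
  shows "compact (frame_tube f c \<sigma> L N \<rho>)"
proof -
  let ?T = "(cball c \<sigma> \<times> cball 0 N) \<inter>
    ({q. norm (mat_of (fst q - L) ** snd q) \<le> \<rho>} \<inter>
     (\<Inter>i. \<Inter>j. {q. snd q $ f i $ j = (if i = j then 1 else 0)}))"
  have "closed {q. norm (mat_of (fst q - L) ** snd q) \<le> \<rho>}"
    by (intro closed_Collect_le continuous_intros)
  moreover have "closed {q :: 'n sym_mat \<times> (real^'p^'n). snd q $ f i $ j = (if i = j then 1 else 0)}" for i j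
    by (intro closed_Collect_eq continuous_intros)
  ultimately have "compact ?T"
    by (intro compact_Int_closed compact_Times compact_cball closed_Int closed_INT ballI)
  then have "compact (fst ` ?T)" by (intro compact_continuous_image continuous_intros)
  also have "fst ` ?T = frame_tube f c \<sigma> L N \<rho>"
  proof (intro equalityI subsetI)
    fix C assume "C \<in> frame_tube f c \<sigma> L N \<rho>"
    then obtain Z where "C \<in> cball c \<sigma>" "norm (mat_of (C - L) ** Z) \<le> \<rho>" "norm Z \<le> N"
      "\<forall>i j. Z $ f i $ j = (if i = j then 1 else 0)"
      unfolding frame_tube_def by blast
    then have "(C, Z) \<in> ?T" by simp
    then show "C \<in> fst ` ?T" by (rule image_eqI[rotated]) simp
  next
    fix C assume "C \<in> fst ` ?T"
    then obtain q where "q \<in> ?T" "C = fst q" by blast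
    then have "C \<in> cball c \<sigma>" "norm (mat_of (C - L) ** snd q) \<le> \<rho>" "norm (snd q) \<le> N"
      "\<forall>i j. snd q $ f i $ j = (if i = j then 1 else 0)"
      by (auto simp del: mem_cball simp: mem_Times_iff)
    then show "C \<in> frame_tube f c \<sigma> L N \<rho>" unfolding frame_tube_def by blast
  qed
  finally show ?thesis .
qed

text \<open>Absorbs the \<open>n ^ p\<close> choices of rows and the exponential constant into
  \<open>n ^ tau p\<close>. For \<open>p = 2\<close> it reduces to \<open>exp 2 \<le> 8\<close>; for
  larger \<open>p\<close>, \<open>2 * p \<le> tau p\<close> and \<open>exp 1 \<le> n\<close> give
  \<open>exp (tau p / 2) \<le> n ^ (tau p - p)\<close>.\<close>

lemma exp_half_power_bound:
  assumes "2 \<le> p" "p \<le> n"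
  shows "real n ^ p * exp (real (tau p) / 2 + 3 / 2) \<le> 4 * exp 1 * real n ^ tau p"
proof (cases "p = 2")
  case True
  have "exp (2::real) = exp 1 * exp 1" by (simp flip: exp_add)
  also have "\<dots> \<le> 2.72 * 2.72" using e_less_272 by (intro mult_mono) auto
  finally have "exp (2::real) \<le> 4 * real n" using assms by simp
  then have "real n ^ 2 * (exp 1 * exp 2) \<le> real n ^ 2 * (exp 1 * (4 * real n))"
    by (intro mult_left_mono) auto
  also have "exp 1 * exp 2 = exp (3 :: real)" by (simp flip: exp_add)
  also have "real n ^ 2 * (exp 1 * (4 * real n)) = 4 * exp 1 * real n ^ 3"
    by (simp add: power2_eq_square power3_eq_cube)
  moreover have "tau 2 = 3" by (simp add: tau_def choose_two)
  ultimately show ?thesis using True by simp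
next
  case False
  then have p: "3 \<le> p" using assms(1) by simp
  have "2 * real p \<le> real (tau p)"
    using p mult_left_mono[of 4 "real p + 1" "real p"] by (simp add: tau_real)
  then have kp: "real (tau p) / 2 \<le> real (tau p) - real p" "p \<le> tau p" by linarith+
  have "exp (real (tau p) / 2) \<le> exp (real (tau p - p))"
    using kp by (simp add: of_nat_diff)
  also have "\<dots> = exp 1 ^ (tau p - p)" by (simp flip: exp_of_nat_mult)
  also have "\<dots> \<le> real n ^ (tau p - p)"
    using e_less_272 p assms(2) by (intro power_mono) auto
  finally have 1: "exp (real (tau p) / 2) \<le> real n ^ (tau p - p)" .
  have "exp (1 / 2 :: real) \<le> exp 1" by simp
  then have 2: "exp (1 / 2 :: real) \<le> 4" using e_less_272 by linarith
  have "exp (real (tau p) / 2 + 3 / 2) = exp (real (tau p) / 2) * (exp (1 / 2) * exp 1)"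
    by (simp flip: exp_add)
  also have "\<dots> \<le> real n ^ (tau p - p) * (4 * exp 1)"
    using 1 2 by (intro mult_mono) auto
  finally have "real n ^ p * exp (real (tau p) / 2 + 3 / 2)
      \<le> real n ^ p * (real n ^ (tau p - p) * (4 * exp 1))"
    by (intro mult_left_mono) auto
  then show ?thesis using kp(2) by (simp add: mult_ac flip: power_add)
qed

text \<open>\<open>tau n / tau p\<close> is at most \<open>(n / p)\<^sup>2\<close> since
  \<open>(n + 1) / (p + 1) \<le> n / p\<close>. The extra 1 in the numerator costs
  \<open>(1 + 1 / tau n)\<close> to the power \<open>tau p / 2\<close>, at most
  \<open>exp (1 / 2)\<close>.\<close>

lemma sqrt_tau_ratio_power_le:
  assumes "1 \<le> p" "p \<le> n"
  shows "sqrt ((real (tau n) + 1) / real (tau p)) ^ tau p \<le> exp (1 / 2) * (real n / real p) ^ tau p"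
proof -
  have "real (tau p) \<le> real (tau n)"
    using assms by (simp add: tau_real mult_mono)
  then have mono: "tau p \<le> tau n" by simp
  have pos: "0 < tau p" "0 < tau n" using assms by (auto simp: tau_def)
  have ratio: "real (tau n) / real (tau p) \<le> (real n / real p)\<^sup>2"
  proof -
    have "real (tau n) / real (tau p) = (real n / real p) * ((real n + 1) / (real p + 1))"
      by (simp add: tau_real)
    also have "\<dots> \<le> (real n / real p) * (real n / real p)"
      using assms by (intro mult_left_mono) (simp_all add: field_simps)
    finally show ?thesis by (simp only: power2_eq_square)
  qed
  have "(real (tau n) + 1) / real (tau p) = real (tau n) / real (tau p) * (1 + 1 / real (tau n))"
    using pos by (simp add: field_simps)
  also have "\<dots> \<le> (real n / real p)\<^sup>2 * exp (1 / real (tau n))"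
    using ratio by (intro mult_mono exp_ge_add_one_self) auto
  finally have "sqrt ((real (tau n) + 1) / real (tau p))
      \<le> sqrt ((real n / real p)\<^sup>2 * exp (1 / real (tau n)))" by (rule real_sqrt_le_mono)
  also have "sqrt (exp (1 / real (tau n))) = exp (1 / real (tau n) / 2)"
    by (intro real_sqrt_unique) (simp_all flip: exp_double)
  then have "sqrt ((real n / real p)\<^sup>2 * exp (1 / real (tau n))) = real n / real p * exp (1 / real (tau n) / 2)"
    by (simp add: real_sqrt_mult)
  finally have "sqrt ((real (tau n) + 1) / real (tau p)) ^ tau p
      \<le> (real n / real p * exp (1 / real (tau n) / 2)) ^ tau p"
    by (intro power_mono) auto
  also have "\<dots> = (real n / real p) ^ tau p * exp (real (tau p) * (1 / real (tau n) / 2))"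
    by (simp only: power_mult_distrib exp_of_nat_mult)
  also have "\<dots> \<le> (real n / real p) ^ tau p * exp (1 / 2)"
    using mono pos by (intro mult_left_mono) auto
  finally show ?thesis by (simp add: mult.commute)
qed

text \<open>The slices along the block have diameter \<open>4 * n * p * \<delta>\<close>. The ratio
  \<open>n / p\<close> from the dimension count cancels \<open>p\<close> and leaves
  \<open>4 * n^2 * \<delta> / \<sigma>\<close>.\<close>

lemma measure_frame_tube_le:
  fixes f :: "'p::finite \<Rightarrow> 'n::finite"
  assumes "inj f" and "0 < \<sigma>" and "0 < \<delta>"
  defines "N \<equiv> sqrt (real CARD('n) * real CARD('p))"
  shows "measure lborel (frame_tube f c \<sigma> L N (2 * N * \<delta>))
    \<le> exp (real (tau CARD('p)) / 2 + 3 / 2) * (4 * real CARD('n) ^ 2 * \<delta> / \<sigma>) ^ tau CARD('p)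
      * measure lborel (cball c \<sigma>)"
proof -
  let ?n = "real CARD('n)" and ?p = "real CARD('p)" and ?k = "tau CARD('p)"
  let ?J = "{sym_unit k l | k l. k \<in> range f \<and> l \<in> range f}"
  have le: "CARD('p) \<le> CARD('n)" using card_inj_on_le[of f UNIV UNIV] assms(1) by simp
  have N: "0 < N" "N * N = ?n * ?p" by (auto simp: N_def)
  have "?J \<subseteq> Basis" by (auto simp: Basis_sym_mat_def)
  moreover have "card ?J = DIM('p sym_mat)"
    using card_sym_units[of "range f"] assms(1) by (simp add: DIM_sym_mat card_image)
  ultimately have J: "?J \<subseteq> Basis" "card ?J = DIM('p sym_mat)" .
  have thin: "dist x y \<le> 2 * N * (2 * N * \<delta>)"
    if x: "x \<in> frame_tube f c \<sigma> L N (2 * N * \<delta>)" and y: "y \<in> frame_tube f c \<sigma> L N (2 * N * \<delta>)"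
      and agree: "\<And>i. i \<in> Basis - ?J \<Longrightarrow> x \<bullet> i = y \<bullet> i" for x y
  proof -
    obtain Z :: "real^'p^'n" where Z: "\<forall>i j. Z $ f i $ j = (if i = j then 1 else 0)"
      "norm Z \<le> N" "norm (mat_of (x - L) ** Z) \<le> 2 * N * \<delta>"
      using x unfolding frame_tube_def by blast
    obtain W :: "real^'p^'n" where W: "\<forall>i j. W $ f i $ j = (if i = j then 1 else 0)"
      "norm W \<le> N" "norm (mat_of (y - L) ** W) \<le> 2 * N * \<delta>"
      using y unfolding frame_tube_def by blast
    show ?thesis
      by (rule dist_le_of_common_block[OF assms(1) Z(1)[rule_format] Z(2,3) W(1)[rule_format] W(2,3) agree])
  qed
  have d: "2 * N * (2 * N * \<delta>) = 4 * ?n * ?p * \<delta>"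
    using N(2) by (simp add: mult_ac)
  have "measure lborel (frame_tube f c \<sigma> L N (2 * N * \<delta>))
    \<le> exp (real ?k / 2 + 1)
      * (sqrt ((real (tau CARD('n)) + 1) / real ?k) * (2 * N * (2 * N * \<delta>)) / \<sigma>) ^ ?k
      * measure lborel (cball c \<sigma>)"
    unfolding DIM_sym_mat[symmetric]
    by (rule measure_thin_slices[OF compact_frame_tube _ assms(2) _ J thin])
      (use N assms(3) in \<open>auto simp: frame_tube_def\<close>)
  also have "\<dots> = exp (real ?k / 2 + 1) * (sqrt ((real (tau CARD('n)) + 1) / real ?k) ^ ?k
      * (4 * ?n * ?p * \<delta> / \<sigma>) ^ ?k) * measure lborel (cball c \<sigma>)"
    unfolding d by (simp add: power_mult_distrib power_divide)
  also have "\<dots> \<le> exp (real ?k / 2 + 1) * ((exp (1 / 2) * (?n / ?p) ^ ?k)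
      * (4 * ?n * ?p * \<delta> / \<sigma>) ^ ?k) * measure lborel (cball c \<sigma>)"
    using assms(2,3) le
    by (intro mult_right_mono mult_left_mono sqrt_tau_ratio_power_le) (auto simp: Suc_leI)
  also have "\<dots> = (exp (real ?k / 2 + 1) * exp (1 / 2)) * ((?n / ?p) * (4 * ?n * ?p * \<delta> / \<sigma>)) ^ ?k
      * measure lborel (cball c \<sigma>)"
    by (simp only: power_mult_distrib mult_ac)
  also have "(?n / ?p) * (4 * ?n * ?p * \<delta> / \<sigma>) = 4 * ?n ^ 2 * \<delta> / \<sigma>"
    by (simp add: power2_eq_square)
  also have "exp (real ?k / 2 + 1) * exp (1 / 2) = exp (real ?k / 2 + 3 / 2)"
    by (simp flip: exp_add)
  finally show ?thesis .
qed

lemma spurious_costs_empty_if_norm_zero: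
  fixes A :: "'m::finite \<Rightarrow> 'n::finite sym_mat"
  assumes "norm_calA A = 0" and "0 \<le> \<epsilon>1" and "0 < \<gamma>"
  shows "spurious_costs TYPE('p::finite) A b R_Y R_lam \<epsilon>0 \<epsilon>1 \<epsilon>2 \<gamma> = {}"
proof (rule equals0I)
  fix C assume "C \<in> spurious_costs TYPE('p) A b R_Y R_lam \<epsilon>0 \<epsilon>1 \<epsilon>2 \<gamma>"
  then obtain Y :: "real^'p^'n" and lam where "spurious_AFAC A b C R_Y R_lam \<epsilon>0 \<epsilon>1 \<epsilon>2 \<gamma> Y lam"
    by (auto simp: spurious_costs_def)
  from spurious_AFAC_full_rank[OF this assms(2), of "axis undefined 1"] assms(1,3)
  show False by (simp add: norm_axis_1)
qed

text \<open>The multipliers \<open>lam\<close> enter only through a net fine enough to move \<open>calA_adj A lam\<close> by at most \<open>\<delta>\<close>.\<close>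

lemma measure_spurious_costs_le:
  fixes A :: "'m::finite \<Rightarrow> 'n::finite sym_mat"
  assumes "2 \<le> CARD('p::finite)"
    and "0 \<le> \<epsilon>1" and "0 < \<gamma>" and "0 < \<sigma>" and "0 < \<delta>" and "\<delta> \<le> \<kappa>"
    and \<delta>: "\<epsilon>1 * norm_calA A / \<gamma> \<le> \<delta>" and \<kappa>: "R_lam * norm_calA A \<le> \<kappa>"
    and meas: "spurious_costs TYPE('p) A b R_Y R_lam \<epsilon>0 \<epsilon>1 \<epsilon>2 \<gamma> \<in> sets borel"
  shows "measure lborel (cball Cbar \<sigma> \<inter> spurious_costs TYPE('p) A b R_Y R_lam \<epsilon>0 \<epsilon>1 \<epsilon>2 \<gamma>)
    \<le> 4 * exp 1 * (3 * \<kappa> / \<delta>) ^ CARD('m) * (4 * real CARD('n) ^ 3 * \<delta> / \<sigma>) ^ tau CARD('p)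
      * measure lborel (cball Cbar \<sigma>)"
    (is "measure lborel (_ \<inter> ?S) \<le> ?bound")
proof (cases "norm_calA A = 0 \<or> CARD('n) < CARD('p)")
  case True
  have "?S = {}"
  proof (cases "norm_calA A = 0")
    case False
    then have "\<not> CARD('p) \<le> CARD('n)" using True by simp
    moreover have "CARD('p) \<le> CARD('n)"
      if sp: "spurious_AFAC A b C R_Y R_lam \<epsilon>0 \<epsilon>1 \<epsilon>2 \<gamma> Y lam" for C and Y :: "real^'p^'n" and lam
      using spurious_AFAC_frame[OF sp assms(2,3)] card_inj_on_le[of _ "UNIV :: 'p set" "UNIV :: 'n set"]
      by (metis finite top_greatest)
    ultimately show ?thesis by (auto simp: spurious_costs_def)
  qed (use assms spurious_costs_empty_if_norm_zero in blast)
  then show ?thesis using assms by simp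
next
  case False
  define a where "a = norm_calA A"
  have a: "0 < a" using False norm_calA_nonneg[of A] by (simp add: a_def)
  have pn: "CARD('p) \<le> CARD('n)" using False by simp
  define N where "N = sqrt (real CARD('n) * real CARD('p))"
  have "0 < \<delta> / a" "0 \<le> \<kappa> / a" using a assms(5,6) by auto
  \<comment> \<open>Radius \<open>\<kappa> / a\<close> contains all admissible multipliers; mesh
    \<open>\<delta> / a\<close> moves the slack by at most \<open>\<delta>\<close>, since
    \<open>calA_adj A\<close> has norm at most \<open>a\<close>.\<close>
  then obtain F :: "(real^'m) set"
    where F: "finite F" "cball 0 (\<kappa> / a) \<subseteq> (\<Union>x\<in>F. cball x (\<delta> / a))"
      "real (card F) \<le> (1 + 2 * (\<kappa> / a) / (\<delta> / a)) ^ DIM(real^'m)"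
    by (rule maximal_separated_set)
  \<comment> \<open>Here \<open>\<delta> \<le> \<kappa>\<close> absorbs the summand 1 into the
    factor 3.\<close>
  have "1 + 2 * (\<kappa> / a) / (\<delta> / a) \<le> 3 * \<kappa> / \<delta>"
    using a assms(5,6) by (simp add: field_simps)
  then have "(1 + 2 * (\<kappa> / a) / (\<delta> / a)) ^ CARD('m) \<le> (3 * \<kappa> / \<delta>) ^ CARD('m)"
    using a assms(5,6) by (intro power_mono) auto
  then have cardF: "real (card F) \<le> (3 * \<kappa> / \<delta>) ^ CARD('m)" using F(3) by (simp only: DIM_cart DIM_real mult_1_right)
  define I where "I = {f :: 'p \<Rightarrow> 'n. inj f}"
  have "card I \<le> card (UNIV :: ('p \<Rightarrow> 'n) set)" by (intro card_mono) auto
  then have cardI: "real (card I) \<le> real CARD('n) ^ CARD('p)" by (simp add: card_fun)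
  let ?T = "\<lambda>l f. frame_tube f Cbar \<sigma> (calA_adj A l) N (2 * N * \<delta>)"
  let ?B = "exp (real (tau CARD('p)) / 2 + 3 / 2) * (4 * real CARD('n) ^ 2 * \<delta> / \<sigma>) ^ tau CARD('p)
      * measure lborel (cball Cbar \<sigma>)"
  have cover: "cball Cbar \<sigma> \<inter> ?S \<subseteq> (\<Union>q\<in>F \<times> I. ?T (fst q) (snd q))"
  proof
    fix C assume C: "C \<in> cball Cbar \<sigma> \<inter> ?S"
    then obtain Y :: "real^'p^'n" and lam where sp: "spurious_AFAC A b C R_Y R_lam \<epsilon>0 \<epsilon>1 \<epsilon>2 \<gamma> Y lam"
      by (auto simp: spurious_costs_def)
    then have "norm lam \<le> R_lam" by (simp add: spurious_AFAC_def)
    also have "\<dots> \<le> \<kappa> / a" using \<kappa> a by (simp add: a_def field_simps)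
    finally obtain l where l: "l \<in> F" "dist l lam \<le> \<delta> / a" using F(2) by auto
    obtain f :: "'p \<Rightarrow> 'n" and Z :: "real^'p^'n" where f: "inj f"
      and Z: "\<And>i j. Z $ f i $ j = (if i = j then 1 else 0)" "norm Z \<le> N"
        "norm (slack A C lam ** Z) \<le> N * (\<epsilon>1 * norm_calA A / \<gamma>)"
      using spurious_AFAC_frame[OF sp assms(2,3)] unfolding N_def by metis
    have "mat_of (C - calA_adj A l) = slack A C lam - mat_of (calA_adj A (l - lam))"
      by (simp add: slack_def linear_diff[OF linear_calA_adj] minus_sym_mat.rep_eq)
    then have "norm (mat_of (C - calA_adj A l) ** Z)
        \<le> norm (slack A C lam ** Z) + norm (mat_of (calA_adj A (l - lam)) ** Z)"
      by (simp add: matrix_mult_diff_left norm_triangle_ineq4)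
    \<comment> \<open>One half of the residual comes from the frame itself, the other from replacing
      \<open>lam\<close> by the net point \<open>l\<close>.\<close>
    also have "\<dots> \<le> N * \<delta> + \<delta> * N"
    proof (rule add_mono)
      show "norm (slack A C lam ** Z) \<le> N * \<delta>"
        using Z(3) \<delta> by (rule order_trans[OF _ mult_left_mono]) (simp add: N_def)
      have "norm (calA_adj A (l - lam)) \<le> a * norm (l - lam)"
        unfolding a_def by (rule norm_calA_adj_le)
      also have "\<dots> \<le> \<delta>" using l(2) a by (simp add: dist_norm field_simps)
      finally have "norm (mat_of (calA_adj A (l - lam))) \<le> \<delta>" by (simp add: norm_sym_mat_def)
      then show "norm (mat_of (calA_adj A (l - lam)) ** Z) \<le> \<delta> * N"
        using Z(2) assms(5) by (intro order_trans[OF norm_matrix_mult_le] mult_mono) auto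
    qed
    also have "\<dots> = 2 * N * \<delta>" by simp
    finally have "C \<in> ?T l f" using C Z unfolding frame_tube_def by blast
    then show "C \<in> (\<Union>q\<in>F \<times> I. ?T (fst q) (snd q))" using l(1) f by (force simp: I_def)
  qed
  have fin: "finite (F \<times> I)" using F(1) by simp
  have "measure lborel (cball Cbar \<sigma> \<inter> ?S) \<le> measure lborel (\<Union>q\<in>F \<times> I. ?T (fst q) (snd q))"
    using cover fin meas
    by (intro measure_mono_fmeasurable fmeasurable_compact compact_UN compact_frame_tube) auto
  also have "\<dots> \<le> (\<Sum>q\<in>F \<times> I. measure lborel (?T (fst q) (snd q)))"
    using fin by (intro measure_UNION_le) (auto intro: borel_compact compact_frame_tube)
  also have "\<dots> \<le> (\<Sum>q\<in>F \<times> I. ?B)"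
    unfolding N_def using assms(4,5) by (intro sum_mono measure_frame_tube_le) (auto simp: I_def)
  also have "\<dots> = real (card F) * real (card I) * ?B" by (simp add: card_cartesian_product)
  also have "\<dots> \<le> (3 * \<kappa> / \<delta>) ^ CARD('m) * real CARD('n) ^ CARD('p) * ?B"
    using cardF cardI assms(4,5,6) by (intro mult_right_mono mult_mono) auto
  also have "\<dots> = (real CARD('n) ^ CARD('p) * exp (real (tau CARD('p)) / 2 + 3 / 2))
      * ((3 * \<kappa> / \<delta>) ^ CARD('m) * (4 * real CARD('n) ^ 2 * \<delta> / \<sigma>) ^ tau CARD('p) * measure lborel (cball Cbar \<sigma>))"
    by (simp only: mult_ac)
  \<comment> \<open>Trading \<open>n ^ p\<close> for \<open>n ^ tau p\<close> is what raises
    \<open>n^2\<close> to \<open>n^3\<close> inside the power.\<close>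
  also have "\<dots> \<le> (4 * exp 1 * real CARD('n) ^ tau CARD('p))
      * ((3 * \<kappa> / \<delta>) ^ CARD('m) * (4 * real CARD('n) ^ 2 * \<delta> / \<sigma>) ^ tau CARD('p) * measure lborel (cball Cbar \<sigma>))"
    using assms(4,5,6) by (intro mult_right_mono exp_half_power_bound assms(1) pn) auto
  also have "\<dots> = 4 * exp 1 * (3 * \<kappa> / \<delta>) ^ CARD('m)
      * (real CARD('n) * (4 * real CARD('n) ^ 2 * \<delta> / \<sigma>)) ^ tau CARD('p) * measure lborel (cball Cbar \<sigma>)"
    by (simp only: power_mult_distrib mult_ac)
  also have "real CARD('n) * (4 * real CARD('n) ^ 2 * \<delta> / \<sigma>) = 4 * real CARD('n) ^ 3 * \<delta> / \<sigma>"
    by (simp add: power2_eq_square power3_eq_cube)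
  finally show ?thesis .
qed

section \<open>Measurability\<close>

lemma ex_nonzero_kernel:
  fixes g :: "'a::euclidean_space \<Rightarrow> 'b::euclidean_space"
  assumes "linear g" and "DIM('b) < DIM('a)"
  obtains x where "x \<noteq> 0" "g x = 0"
proof -
  have "\<not> inj g"
  proof
    assume "inj g"
    then have "dim (range g) = DIM('a)"
      using dim_image_eq[OF assms(1), of UNIV] by simp
    then show False using assms(2) dim_subset_UNIV[of "range g"] by simp
  qed
  then show thesis using that linear_injective_0[OF assms(1)] by blast
qed

lemma linear_calA_mult_transpose: "linear (\<lambda>U. calA A (U ** transpose Y))"
  by (rule linearI)
    (simp_all add: calA_def vec_eq_iff matrix_matrix_mult_def inner_vec_def
      distrib_right distrib_left sum.distrib sum_distrib_left mult_ac)

text \<open>Sliding a feasible direction along the kernel of \<open>U \<mapsto> calA A (U Y\<^sup>T)\<close>, away from the origin,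
  makes the constraint strict after renormalisation; hence only strict constraints matter.\<close>

lemma second_order_strict_iff:
  fixes A :: "'m::finite \<Rightarrow> 'n::finite sym_mat" and S :: "real^'n^'n" and Y :: "real^'p^'n"
  assumes "CARD('m) < CARD('n) * CARD('p)" and "0 < \<gamma>"
  defines "g \<equiv> \<lambda>U. calA A (U ** transpose Y)"
  shows "(\<forall>U. norm U = 1 \<and> norm (g U) \<le> \<gamma> \<longrightarrow> - \<epsilon> \<le> S \<bullet> (U ** transpose U))
    \<longleftrightarrow> (\<forall>U. norm U = 1 \<and> norm (g U) < \<gamma> \<longrightarrow> - \<epsilon> \<le> S \<bullet> (U ** transpose U))"
    (is "?weak \<longleftrightarrow> ?strict")
proof
  assume strict: ?strict
  have g: "linear g" unfolding g_def by (rule linear_calA_mult_transpose)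
  obtain K0 where K0: "K0 \<noteq> 0" "g K0 = 0"
    using ex_nonzero_kernel[OF g] assms(1) by auto
  show ?weak
  proof (intro allI impI)
    fix U :: "real^'p^'n" assume U: "norm U = 1 \<and> norm (g U) \<le> \<gamma>"
    \<comment> \<open>The sign of the kernel vector is chosen so that moving along it increases the
      norm of \<open>U\<close>; \<open>g\<close> stays constant, so renormalising shrinks it
      strictly below \<open>\<gamma>\<close>.\<close>
    obtain K where K: "K \<noteq> 0" "g K = 0" "0 \<le> U \<bullet> K"
      using that[of K0] that[of "- K0"] K0 linear_neg[OF g, of K0] by fastforce
    define V where "V t = U + t *\<^sub>R K" for t
    have pos: "0 \<le> S \<bullet> (V t ** transpose (V t)) + \<epsilon> * (norm (V t))\<^sup>2" if t: "0 < t" for t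
    proof -
      have "(norm (V t))\<^sup>2 = U \<bullet> U + (2 * t * (U \<bullet> K) + t\<^sup>2 * (K \<bullet> K))"
        unfolding V_def power2_norm_eq_inner
        by (simp add: inner_add_left inner_add_right inner_commute[of K U] power2_eq_square algebra_simps)
      then have "(norm (V t))\<^sup>2 = 1 + (2 * t * (U \<bullet> K) + t\<^sup>2 * (norm K)\<^sup>2)"
        using U by (simp add: dot_square_norm)
      moreover have "0 < 2 * t * (U \<bullet> K) + t\<^sup>2 * (norm K)\<^sup>2"
        using K t by (intro add_nonneg_pos) auto
      ultimately have "1 < (norm (V t))\<^sup>2" by simp
      then have nV: "1 < norm (V t)" using power2_less_imp_less[of 1 "norm (V t)"] by simp
      define W where "W = V t /\<^sub>R norm (V t)"
      have "g (V t) = g U" using K by (simp add: V_def linear_add[OF g] linear_scale[OF g])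
      then have "norm (g W) = norm (g U) / norm (V t)"
        by (simp add: W_def linear_scale[OF g] divide_inverse mult.commute)
      also have "\<dots> \<le> \<gamma> / norm (V t)" using U nV by (intro divide_right_mono) auto
      also have "\<dots> < \<gamma>" using nV assms(2) by (simp add: divide_less_eq)
      finally have "norm (g W) < \<gamma>" .
      have "V t \<noteq> 0" using nV by auto
      then have VW: "norm W = 1" "V t = norm (V t) *\<^sub>R W" by (simp_all add: W_def)
      then have "- \<epsilon> \<le> S \<bullet> (W ** transpose W)" using strict \<open>norm (g W) < \<gamma>\<close> by blast
      moreover have "V t ** transpose (V t) = (norm (V t))\<^sup>2 *\<^sub>R (W ** transpose W)"
        by (subst (1 2) VW(2))
          (simp add: vec_eq_iff matrix_matrix_mult_def transpose_def sum_distrib_left power2_eq_square mult_ac)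
      ultimately have "S \<bullet> (V t ** transpose (V t)) + \<epsilon> * (norm (V t))\<^sup>2
          = (norm (V t))\<^sup>2 * (S \<bullet> (W ** transpose W) + \<epsilon>)" "0 \<le> S \<bullet> (W ** transpose W) + \<epsilon>"
        by (simp_all add: algebra_simps)
      then show ?thesis by simp
    qed
    \<comment> \<open>The inequality holds for every \<open>t > 0\<close>; continuity carries it to
      \<open>t = 0\<close>, where \<open>V t\<close> is \<open>U\<close>.\<close>
    define q where "q t = S \<bullet> (V t ** transpose (V t)) + \<epsilon> * (norm (V t))\<^sup>2" for t
    have "continuous_on UNIV q" unfolding q_def V_def by (intro continuous_intros)
    then have "isCont q 0" by (simp add: continuous_on_eq_continuous_at)
    then have "(q \<longlongrightarrow> q 0) (at_right 0)"
      by (simp add: isCont_def filterlim_at_split)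
    moreover have "\<forall>\<^sub>F t in at_right 0. 0 \<le> q t"
      using pos by (auto simp: eventually_at_right_field q_def intro!: exI[of _ 1])
    ultimately have "0 \<le> q 0" by (rule tendsto_lowerbound) simp
    then show "- \<epsilon> \<le> S \<bullet> (U ** transpose U)" using U by (simp add: q_def V_def)
  qed
qed auto

text \<open>An open set is a countable union of compact sets, so the projection is a countable union
  of compact sets.\<close>

lemma sets_borel_fst_image:
  fixes S T :: "('a::euclidean_space \<times> 'b::euclidean_space) set"
  assumes "closed S" and "open T"
  shows "fst ` (S \<inter> T) \<in> sets borel"
proof -
  obtain K where K: "\<And>n::nat. compact (K n)" "\<Union> (range K) = T"
    using open_Union_compact_subsets[OF assms(2)] by metis
  have "fst ` (S \<inter> T) = (\<Union>n. fst ` (S \<inter> K n))" using K(2) by auto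
  moreover have "compact (fst ` (S \<inter> K n))" for n
    using assms(1) K(1)
    by (intro compact_continuous_image continuous_intros closed_Int_compact)
  ultimately show ?thesis by (auto intro!: sets.countable_UN simp: image_subset_iff borel_compact)
qed

text \<open>The spurious costs are a projection of a closed set intersected with an open one. With a
  strict constraint the second-order implication reads \<open>\<gamma> \<le> norm ...\<close> or
  \<open>- \<epsilon>2 \<le> ...\<close>, a closed condition in the pair for each \<open>U\<close>;
  failure of semidefiniteness is open, being witnessed by one vector \<open>v\<close>.\<close>

lemma sets_borel_spurious_costs_aux:
  fixes A :: "'m::finite \<Rightarrow> 'n::finite sym_mat"
  assumes "CARD('m) < CARD('n) * CARD('p::finite)" and "0 \<le> \<epsilon>1" and "0 < \<gamma>"
  shows "spurious_costs TYPE('p) A b R_Y R_lam \<epsilon>0 \<epsilon>1 \<epsilon>2 \<gamma> \<in> sets borel"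
proof -
  let ?S = "\<lambda>q :: 'n sym_mat \<times> (real^'p^'n) \<times> (real^'m). slack A (fst q) (snd (snd q))"
  let ?Y = "\<lambda>q :: 'n sym_mat \<times> (real^'p^'n) \<times> (real^'m). fst (snd q)"
  define P where "P = {q. norm (calA A (?Y q ** transpose (?Y q)) - b) \<le> \<epsilon>0}
    \<inter> {q. norm (?S q ** ?Y q) \<le> \<epsilon>1}
    \<inter> {q. norm (?Y q) \<le> R_Y} \<inter> {q. norm (snd (snd q)) \<le> R_lam}
    \<inter> (\<Inter>U \<in> {U. norm U = 1}. {q. \<gamma> \<le> norm (calA A (U ** transpose (?Y q)))}
        \<union> {q. - \<epsilon>2 \<le> ?S q \<bullet> (U ** transpose U)})"
  define T where "T = (\<Union>v. {q. v \<bullet> (?S q *v v) + \<epsilon>2 * (v \<bullet> v) < 0})"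
  have "closed P"
    unfolding P_def
    by (intro closed_Int closed_INT closed_Un closed_Collect_le ballI continuous_intros)
  moreover have "open T"
    unfolding T_def by (intro open_UN open_Collect_less ballI continuous_intros)
  moreover have "spurious_AFAC A b C R_Y R_lam \<epsilon>0 \<epsilon>1 \<epsilon>2 \<gamma> Y lam \<longleftrightarrow> (C, Y, lam) \<in> P \<inter> T"
    for C lam and Y :: "real^'p^'n"
  proof -
    have strict: "AFAC A b C \<epsilon>0 \<epsilon>1 \<epsilon>2 \<gamma> Y lam \<and> norm Y \<le> R_Y \<and> norm lam \<le> R_lam \<longleftrightarrow> (C, Y, lam) \<in> P"
      unfolding AFAC_def second_order_strict_iff[OF assms(1,3)]
      by (auto simp: P_def not_le)
    show ?thesis
    proof (cases "(C, Y, lam) \<in> P")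
      case True
      then have "approx_optimal A b C \<epsilon>0 (R_Y * \<epsilon>1) \<epsilon>2 (Y ** transpose Y) lam \<longleftrightarrow> (C, Y, lam) \<notin> T"
        using strict assms(2)
        by (subst approx_optimal_iff_psd[where \<gamma> = \<gamma>]) (auto simp: psd_slack_iff T_def not_less)
      then show ?thesis using True strict by (auto simp: spurious_AFAC_def)
    qed (use strict in \<open>auto simp: spurious_AFAC_def\<close>)
  qed
  then have "spurious_costs TYPE('p) A b R_Y R_lam \<epsilon>0 \<epsilon>1 \<epsilon>2 \<gamma> = fst ` (P \<inter> T)"
    unfolding spurious_costs_def by (force simp: image_iff)
  ultimately show ?thesis by (simp add: sets_borel_fst_image)
qed

text \<open>For \<open>p \<le> n\<close>, \<open>tau p \<le> p * p \<le> n * p\<close> supplies the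
  dimension count needed for a kernel direction. For \<open>p > n\<close> no frame can have
  injective row indices, so the set is empty.\<close>

lemma sets_borel_spurious_costs:
  fixes A :: "'m::finite \<Rightarrow> 'n::finite sym_mat"
  assumes "CARD('m) < tau CARD('p::finite)" and "0 \<le> \<epsilon>1" and "0 < \<gamma>"
  shows "spurious_costs TYPE('p) A b R_Y R_lam \<epsilon>0 \<epsilon>1 \<epsilon>2 \<gamma> \<in> sets borel"
proof (cases "CARD('p) \<le> CARD('n)")
  case True
  have "real (tau CARD('p)) \<le> real (CARD('p) * CARD('p))"
    using mult_left_mono[of 1 "real CARD('p)" "real CARD('p)"] by (simp add: tau_real Suc_leI algebra_simps)
  then have "tau CARD('p) \<le> CARD('p) * CARD('p)" by (simp only: of_nat_le_iff)
  also have "\<dots> \<le> CARD('n) * CARD('p)" using True by simp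
  finally show ?thesis using assms by (intro sets_borel_spurious_costs_aux) auto
next
  case False
  have "\<not> spurious_AFAC A b C R_Y R_lam \<epsilon>0 \<epsilon>1 \<epsilon>2 \<gamma> Y lam" for C and Y :: "real^'p^'n" and lam
  proof
    assume "spurious_AFAC A b C R_Y R_lam \<epsilon>0 \<epsilon>1 \<epsilon>2 \<gamma> Y lam"
    then obtain f :: "'p \<Rightarrow> 'n" where "inj f" using spurious_AFAC_frame assms(2,3) by metis
    then show False using False card_inj_on_le[of f UNIV UNIV] by simp
  qed
  then show ?thesis by (simp add: spurious_costs_def)
qed

section \<open>The probability bound\<close>

text \<open>Measurability of the event is part of the conclusion because \<open>measure\<close>
  takes the default value 0 on non-measurable sets, where the inequality would say nothing.\<close>

theorem theorem3p5:
  fixes A :: "'m::finite \<Rightarrow> 'n::finite sym_mat" and b :: "real^'m"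
    and R_Y R_lam \<epsilon>0 \<epsilon>1 \<epsilon>2 \<gamma> \<sigma> \<delta> \<kappa> :: real
    and Cbar :: "'n sym_mat"
    and M :: "'w measure" and C :: "'w \<Rightarrow> 'n sym_mat"
  assumes "tau CARD('p::finite) > CARD('m)"
    and "R_Y \<ge> 0" and "R_lam \<ge> 0"
    and "\<epsilon>0 \<ge> 0" and "\<epsilon>1 \<ge> 0" and "\<epsilon>2 \<ge> 0" and "\<gamma> > 0"
    and "\<sigma> > 0"
    and "prob_space M" and "C \<in> borel_measurable M"
    and "distr M borel C = uniform_measure lborel (cball Cbar \<sigma>)"
    and "\<delta> = \<epsilon>1 * norm_calA A / \<gamma>"
    and "\<kappa> = R_lam * norm_calA A"
    and "\<delta> < \<sigma> / (4 * real CARD('n) ^ 3)"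
    and "\<delta> \<le> \<kappa>"
  shows "{\<omega> \<in> space M. C \<omega> \<in> spurious_costs TYPE('p) A b R_Y R_lam \<epsilon>0 \<epsilon>1 \<epsilon>2 \<gamma>} \<in> sets M \<and>
    \<P>(\<omega> in M. C \<omega> \<in> spurious_costs TYPE('p) A b R_Y R_lam \<epsilon>0 \<epsilon>1 \<epsilon>2 \<gamma>)
      \<le> 4 * exp 1 * \<delta> ^ (tau CARD('p) - CARD('m)) * (3 * \<kappa>) ^ CARD('m)
          * (4 * real CARD('n) ^ 3 / \<sigma>) ^ tau CARD('p)"
proof -
  let ?S = "spurious_costs TYPE('p) A b R_Y R_lam \<epsilon>0 \<epsilon>1 \<epsilon>2 \<gamma>"
  let ?ball = "cball Cbar \<sigma>"
  let ?m = "CARD('m)" and ?k = "tau CARD('p)" and ?c = "4 * real CARD('n) ^ 3 / \<sigma>"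
  interpret prob_space M by fact
  note [measurable] = \<open>C \<in> borel_measurable M\<close>
  have S [measurable]: "?S \<in> sets borel"
    using assms by (intro sets_borel_spurious_costs) auto
  \<comment> \<open>\<open>tau 1 = 1\<close> and \<open>m\<close> is at least 1, so
    \<open>m < tau p\<close> rules out \<open>p = 1\<close>.\<close>
  have two: "2 \<le> CARD('p)"
  proof (rule ccontr)
    assume "\<not> ?thesis"
    then have "CARD('p) = 1" using zero_less_card_finite[where 'a = 'p] by linarith
    then have "?k \<le> 1" by (simp add: tau_def numeral_2_eq_2)
    moreover have "1 \<le> ?m" by (simp add: Suc_leI)
    ultimately show False using assms(1) by simp
  qed
  have ball: "0 < measure lborel ?ball"
    using assms(8) by (simp add: measure_lborel_cball)
  have "prob {\<omega> \<in> space M. C \<omega> \<in> ?S} = measure (distr M borel C) ?S"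
    by (subst measure_distr) (auto intro!: arg_cong[where f = prob])
  also have "\<dots> = measure lborel (?ball \<inter> ?S) / measure lborel ?ball"
    unfolding assms(11)
    using ball by (intro measure_uniform_measure)
      (auto simp: measure_def emeasure_compact_finite[THEN less_imp_neq, simplified])
  finally have prob_eq: "prob {\<omega> \<in> space M. C \<omega> \<in> ?S} = measure lborel (?ball \<inter> ?S) / measure lborel ?ball" .
  \<comment> \<open>The estimate divides by \<open>\<delta>\<close>, which may be 0, so it is applied to \<open>\<delta> + t\<close> and \<open>\<kappa> + t\<close> with \<open>t \<rightarrow> 0\<close>.\<close>
  define r where "r t = 4 * exp 1 * (\<delta> + t) ^ (?k - ?m) * (3 * (\<kappa> + t)) ^ ?m * ?c ^ ?k" for t
  have \<delta>0: "0 \<le> \<delta>"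
    using assms(5,7,12) norm_calA_nonneg[of A] by simp
  have bound: "prob {\<omega> \<in> space M. C \<omega> \<in> ?S} \<le> r t" if t: "0 < t" for t
  proof -
    have "measure lborel (?ball \<inter> ?S)
      \<le> 4 * exp 1 * (3 * (\<kappa> + t) / (\<delta> + t)) ^ ?m * (4 * real CARD('n) ^ 3 * (\<delta> + t) / \<sigma>) ^ ?k
        * measure lborel ?ball"
      using two assms \<delta>0 t S by (intro measure_spurious_costs_le) auto
    also have "4 * exp 1 * (3 * (\<kappa> + t) / (\<delta> + t)) ^ ?m * (4 * real CARD('n) ^ 3 * (\<delta> + t) / \<sigma>) ^ ?k = r t"
    proof -
      \<comment> \<open>Since \<open>m < tau p\<close>, \<open>m\<close> of the \<open>tau p\<close>
        factors \<open>\<delta> + t\<close> can be spent on cancelling the denominator of the net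
        size.\<close>
      have 1: "(\<delta> + t) ^ ?k = (\<delta> + t) ^ (?k - ?m) * (\<delta> + t) ^ ?m"
        using assms(1) by (simp flip: power_add)
      have 2: "(3 * (\<kappa> + t) / (\<delta> + t)) ^ ?m * (\<delta> + t) ^ ?m = (3 * (\<kappa> + t)) ^ ?m"
        using \<delta>0 t by (simp flip: power_mult_distrib)
      have "4 * real CARD('n) ^ 3 * (\<delta> + t) / \<sigma> = ?c * (\<delta> + t)" by simp
      then have "4 * exp 1 * (3 * (\<kappa> + t) / (\<delta> + t)) ^ ?m * (4 * real CARD('n) ^ 3 * (\<delta> + t) / \<sigma>) ^ ?k
          = 4 * exp 1 * (\<delta> + t) ^ (?k - ?m) * ((3 * (\<kappa> + t) / (\<delta> + t)) ^ ?m * (\<delta> + t) ^ ?m) * ?c ^ ?k"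
        by (simp only: power_mult_distrib[of ?c "\<delta> + t"] power_mult_distrib[of "\<delta> + t" ?c] 1 mult_ac)
      then show ?thesis by (simp only: 2 r_def)
    qed
    finally show ?thesis using ball by (simp add: prob_eq divide_le_eq)
  qed
  have "continuous_on UNIV r" unfolding r_def by (intro continuous_intros)
  then have "(r \<longlongrightarrow> r 0) (at_right 0)"
    by (simp add: continuous_on_eq_continuous_at isCont_def filterlim_at_split)
  moreover have "\<forall>\<^sub>F t in at_right 0. prob {\<omega> \<in> space M. C \<omega> \<in> ?S} \<le> r t"
    using bound by (auto simp: eventually_at_right_field intro!: exI[of _ 1])
  ultimately have "prob {\<omega> \<in> space M. C \<omega> \<in> ?S} \<le> r 0"
    by (rule tendsto_lowerbound) simp
  moreover have "{\<omega> \<in> space M. C \<omega> \<in> ?S} \<in> sets M" by measurable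
  ultimately show ?thesis by (simp add: r_def)
qed

end
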